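(* Let $k$ be a field, let $n\ge 2$ be an integer, and let $R=k[x_1,\ldots,x_n]/I$, where $I$ is the ideal generated by $x_1^2$ and all products $x_ix_j$ with $1\le i\ne j\le n$. Let $O(n)_*$ be the complex of free $R$-modules obtained by applying the Chain Complex Construction Procedure to $R$ with initial map $R\xrightarrow{x_1}R$. Then $O(n)_*$ is a free resolution of the $R$-module $R/(x_1)$; that is, $O(n)_*\xrightarrow{d_0}R/(x_1)\to 0$ is an exact sequence, where $d_0:O(n)_0=R\to R/(x_1)$ is the canonical projection.
   Context: **The procedure for this ring.** The Chain Complex Construction Procedure builds a graded diagram of vertices in degrees $d\ge 0$ and arrows, labelled by indices in $\{1,\ldots,n\}$, from degree $d+1$ to degree $d$. Since every product $x_ix_j$ with $i\neq j$ lies in $I$, only the "column completion" rule of the procedure occurs, and the procedure reads as follows. Start with one vertex in degree $0$, one vertex in degree $1$, and one arrow from the latter to the former with label $1$. Given the arrows from degree $d+1$ to degree $d$ ($d\ge 0$), the vertices of degree $d+2$ and arrows from degree $d+2$ to degree $d+1$ are obtained as follows: for every arrow $v\to w$ with label $i$ from degree $d+1$ to degree $d$, and every $j\in\{1,\ldots,n\}$ with $x_ix_j\in I$ (that is, all $j\in\{1,\ldots,n\}$ if $i=1$, and all $j\ne i$ if $i\ge 2$), add a new vertex $u$ of degree $d+2$ and an arrow $u\to v$ with label $j$. Repeat indefinitely. The complex $O(n)_*$ has in degree $d$ the free $R$-module with basis the vertices of degree $d$ (and $0$ for $d<0$), and the component of the differential from the copy of $R$ at $v$ to the copy of $R$ at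 $w$ is multiplication by $x_i$ if there is an arrow $v\to w$ with label $i$, and $0$ otherwise. *)

theory Defs
  imports "HOL-Algebra.QuotRing" "HOL-Algebra.Module" "HOL-Library.Poly_Mapping"
begin

section \<open>Free resolutions of modules over a commutative ring\<close>

definition linear_maps ::
    "('a, 'm) ring_scheme \<Rightarrow> ('a, 'b, 'p) module_scheme \<Rightarrow> ('a, 'c, 'q) module_scheme \<Rightarrow> ('b \<Rightarrow> 'c) set"
  where "linear_maps R M N =
    {h \<in> carrier M \<rightarrow> carrier N.
      (\<forall>x\<in>carrier M. \<forall>y\<in>carrier M. h (x \<oplus>\<^bsub>M\<^esub> y) = h x \<oplus>\<^bsub>N\<^esub> h y) \<and>
      (\<forall>a\<in>carrier R. \<forall>x\<in>carrier M. h (a \<odot>\<^bsub>M\<^esub> x) = a \<odot>\<^bsub>N\<^esub> h x)}"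

definition module_basis :: "('a, 'm) ring_scheme \<Rightarrow> ('a, 'b, 'p) module_scheme \<Rightarrow> 'b set \<Rightarrow> bool"
  where "module_basis R M B \<longleftrightarrow>
    B \<subseteq> carrier M \<and>
    (\<forall>x\<in>carrier M. \<exists>!c. c \<in> B \<rightarrow>\<^sub>E carrier R \<and> finite {b\<in>B. c b \<noteq> \<zero>\<^bsub>R\<^esub>} \<and>
       x = (\<Oplus>\<^bsub>M\<^esub>b\<in>{b\<in>B. c b \<noteq> \<zero>\<^bsub>R\<^esub>}. c b \<odot>\<^bsub>M\<^esub> b))"

definition free_module :: "('a, 'm) ring_scheme \<Rightarrow> ('a, 'b, 'p) module_scheme \<Rightarrow> bool"
  where "free_module R M \<longleftrightarrow> module R M \<and> (\<exists>B. module_basis R M B)"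

text \<open>In the sequence
  \<open>\<dots> \<rightarrow> F 2 \<rightarrow> F 1 \<rightarrow> F 0 \<rightarrow> M \<rightarrow> 0\<close>
  the map \<open>D d\<close> goes from \<open>F (d + 1)\<close> to \<open>F d\<close>, and \<open>e\<close> is the augmentation \<open>F 0 \<rightarrow> M\<close>.\<close>

definition free_resolution ::
    "('a, 'm) ring_scheme \<Rightarrow> (nat \<Rightarrow> ('a, 'b, 'p) module_scheme) \<Rightarrow> (nat \<Rightarrow> 'b \<Rightarrow> 'b) \<Rightarrow>
     ('a, 'c, 'q) module_scheme \<Rightarrow> ('b \<Rightarrow> 'c) \<Rightarrow> bool"
  where "free_resolution R F D M e \<longleftrightarrow>
    module R M \<and>
    (\<forall>d. free_module R (F d)) \<and>
    (\<forall>d. D d \<in> linear_maps R (F (Suc d)) (F d)) \<and>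
    e \<in> linear_maps R (F 0) M \<and>
    e ` carrier (F 0) = carrier M \<and>
    a_kernel (F 0) M e = D 0 ` carrier (F 1) \<and>
    (\<forall>d. a_kernel (F (Suc d)) (F d) (D d) = D (Suc d) ` carrier (F (Suc (Suc d))))"

text \<open>The record type of modules extends that of rings; the fields \<open>mult\<close> and \<open>one\<close> play no role
  in a module.\<close>

definition free_module_on :: "('a, 'm) ring_scheme \<Rightarrow> 'v set \<Rightarrow> ('a, 'v \<Rightarrow> 'a) module"
  where "free_module_on R V =
    \<lparr>carrier = {f \<in> V \<rightarrow>\<^sub>E carrier R. finite {v\<in>V. f v \<noteq> \<zero>\<^bsub>R\<^esub>}},
     mult = undefined, one = undefined,
     zero = (\<lambda>v\<in>V. \<zero>\<^bsub>R\<^esub>), add = (\<lambda>f g. \<lambda>v\<in>V. f v \<oplus>\<^bsub>R\<^esub> g v),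
     smult = (\<lambda>a f. \<lambda>v\<in>V. a \<otimes>\<^bsub>R\<^esub> f v)\<rparr>"

definition quotient_module :: "('a, 'm) ring_scheme \<Rightarrow> 'a set \<Rightarrow> ('a, 'a set) module"
  where "quotient_module R J =
    \<lparr>carrier = carrier (R Quot J), mult = mult (R Quot J), one = one (R Quot J),
     zero = zero (R Quot J), add = add (R Quot J),
     smult = (\<lambda>a X. (J +>\<^bsub>R\<^esub> a) \<otimes>\<^bsub>R Quot J\<^esub> X)\<rparr>"


section \<open>The ring\<close>

text \<open>A monomial is its finitely supported exponent vector, and a polynomial is a finitely
  supported function from monomials to coefficients.\<close>

type_synonym 'k mpoly = "(nat \<Rightarrow>\<^sub>0 nat) \<Rightarrow>\<^sub>0 'k"

definition poly_var :: "nat \<Rightarrow> 'k::field mpoly"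
  where "poly_var i = Poly_Mapping.single (Poly_Mapping.single i 1) 1"

definition mpoly_ring :: "nat \<Rightarrow> 'k::field mpoly ring"
  where "mpoly_ring n =
    \<lparr>carrier = {p. \<forall>m\<in>Poly_Mapping.keys p. Poly_Mapping.keys m \<subseteq> {1..n}},
     mult = (*), one = 1, zero = 0, add = (+)\<rparr>"

definition rel_ideal :: "nat \<Rightarrow> 'k::field mpoly set"
  where "rel_ideal n = Idl\<^bsub>mpoly_ring n\<^esub>
    ({poly_var 1 ^ 2} \<union> {poly_var i * poly_var j | i j. i \<in> {1..n} \<and> j \<in> {1..n} \<and> i \<noteq> j})"

definition base_ring :: "nat \<Rightarrow> 'k::field mpoly set ring"
  where "base_ring n = mpoly_ring n Quot rel_ideal n"

definition ring_var :: "nat \<Rightarrow> nat \<Rightarrow> 'k::field mpoly set"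
  where "ring_var n i = rel_ideal n +>\<^bsub>mpoly_ring n\<^esub> poly_var i"


section \<open>The complex\<close>

text \<open>Every vertex of positive degree is the source of exactly one arrow, so a vertex is
  named by the list of labels along the path from it down to degree 0.  The new vertex \<open>u\<close>
  added for an arrow \<open>v \<rightarrow> w\<close> and an index \<open>j\<close> is thus \<open>j # v\<close>.
  A triple \<open>(v, i, w)\<close> in \<open>arrows I n d\<close> is an arrow \<open>v \<rightarrow> w\<close> with label \<open>i\<close> from degree \<open>d + 1\<close>
  to degree \<open>d\<close>.\<close>

type_synonym vertex = "nat list"

primrec arrows :: "'k::field mpoly set \<Rightarrow> nat \<Rightarrow> nat \<Rightarrow> (vertex \<times> nat \<times> vertex) set"
  where
    "arrows I n 0 = {([1], 1, [])}"
  | "arrows I n (Suc d) =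
      {(j # v, j, v) | i j v w.
         (v, i, w) \<in> arrows I n d \<and> j \<in> {1..n} \<and> poly_var i * poly_var j \<in> I}"

primrec vertices :: "'k::field mpoly set \<Rightarrow> nat \<Rightarrow> nat \<Rightarrow> vertex set"
  where
    "vertices I n 0 = {[]}"
  | "vertices I n (Suc d) = {v. \<exists>i w. (v, i, w) \<in> arrows I n d}"

definition chain_module ::
    "nat \<Rightarrow> nat \<Rightarrow> ('k::field mpoly set, vertex \<Rightarrow> 'k mpoly set) module"
  where "chain_module n d =
    free_module_on (base_ring n) (vertices (rel_ideal n :: 'k mpoly set) n d)"

definition diff_entry :: "nat \<Rightarrow> nat \<Rightarrow> vertex \<Rightarrow> vertex \<Rightarrow> 'k::field mpoly set"
  where "diff_entry n d v w =
    (if \<exists>i. (v, i, w) \<in> arrows (rel_ideal n :: 'k mpoly set) n d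
     then ring_var n (THE i. (v, i, w) \<in> arrows (rel_ideal n :: 'k mpoly set) n d)
     else \<zero>\<^bsub>base_ring n\<^esub>)"

text \<open>There are finitely many vertices in each degree, so the sum below is a genuine finite sum.\<close>

definition chain_diff :: "nat \<Rightarrow> nat \<Rightarrow> (vertex \<Rightarrow> 'k::field mpoly set) \<Rightarrow> (vertex \<Rightarrow> 'k mpoly set)"
  where "chain_diff n d f =
    (\<lambda>w\<in>vertices (rel_ideal n :: 'k mpoly set) n d.
       \<Oplus>\<^bsub>base_ring n\<^esub>v\<in>vertices (rel_ideal n :: 'k mpoly set) n (Suc d).
         diff_entry n d v w \<otimes>\<^bsub>base_ring n\<^esub> f v)"

definition var1_ideal :: "nat \<Rightarrow> 'k::field mpoly set set"
  where "var1_ideal n = Idl\<^bsub>base_ring n\<^esub> {ring_var n 1}"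

text \<open>The degree 0 module is the copy of the base ring at the vertex \<open>[]\<close>; the augmentation is
  the canonical projection on that copy.\<close>

definition augmentation :: "nat \<Rightarrow> (vertex \<Rightarrow> 'k::field mpoly set) \<Rightarrow> 'k mpoly set set"
  where "augmentation n f = var1_ideal n +>\<^bsub>base_ring n\<^esub> f []"

end

theory Submission
  imports Defs
begin

text \<open>
  Write \<open>R = k[x\<^sub>1, \<dots>, x\<^sub>n] / I\<close>. Since \<open>I\<close> is generated by monomials, \<open>R\<close> has a basis consisting
  of the monomials outside \<open>I\<close>, namely \<open>1\<close>, \<open>x\<^sub>1\<close> and \<open>x\<^sub>i\<^sup>e\<close> with \<open>i \<ge> 2\<close> and \<open>e \<ge> 1\<close>
  (\<open>rel_ideal_eq_vanishing_polys\<close>). Two facts about \<open>R\<close> follow by inspecting monomials.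

  \<^item> The ideals \<open>(x\<^sub>1), \<dots>, (x\<^sub>n)\<close> are independent: if \<open>\<Sum>\<^sub>j x\<^sub>j a\<^sub>j = 0\<close>, then \<open>x\<^sub>j a\<^sub>j = 0\<close> for every
    \<open>j\<close> (\<open>ring_var_multiples_independent\<close>).
  \<^item> The annihilator of \<open>x\<^sub>i\<close> is generated by the \<open>x\<^sub>j\<close> with \<open>x\<^sub>i x\<^sub>j = 0\<close>
    (\<open>annihilator_of_ring_var\<close>).

  The diagram of vertices is a tree: from each vertex of positive degree there is one arrow, and
  the arrows into a vertex carry distinct labels. The component of the differential at \<open>w\<close> is
  therefore \<open>\<Sum>\<^sub>j x\<^sub>j f(j # w)\<close>, where \<open>j\<close> ranges over the labels of the arrows into \<open>w\<close>
  (\<open>chain_diff_apply\<close>). By independence, \<open>f\<close> is a cycle if and only if its value at each vertex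
  \<open>j # w\<close> annihilates \<open>x\<^sub>j\<close>. On the other hand, \<open>f\<close> is a boundary if and only if its value at each
  vertex \<open>v\<close> lies in the ideal generated by the labels of the arrows into \<open>v\<close>. For \<open>v = j # w\<close>
  the procedure has attached precisely the labels \<open>l\<close> with \<open>x\<^sub>j x\<^sub>l = 0\<close>, so the second
  fact says that this ideal is the annihilator of \<open>x\<^sub>j\<close>, and cycles are boundaries
  (\<open>chain_diff_exact\<close>). In degree 0 the image of multiplication by \<open>x\<^sub>1\<close> is the kernel of the
  projection to \<open>R / (x\<^sub>1)\<close> (\<open>augmentation_exact\<close>).
\<close>

section \<open>Polynomials and their monomials\<close>

lemma sum_monomials: "p = (\<Sum>m\<in>Poly_Mapping.keys p. Poly_Mapping.single m (Poly_Mapping.lookup p m))"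
proof (rule poly_mapping_eqI)
  fix k
  have "(\<Sum>m\<in>Poly_Mapping.keys p. Poly_Mapping.lookup p m when m = k) = Poly_Mapping.lookup p k"
    by (cases "k \<in> Poly_Mapping.keys p") (auto simp: when_def in_keys_iff)
  then show "Poly_Mapping.lookup p k =
      Poly_Mapping.lookup (\<Sum>m\<in>Poly_Mapping.keys p. Poly_Mapping.single m (Poly_Mapping.lookup p m)) k"
    by (simp add: lookup_sum lookup_single)
qed

lemma lookup_poly_var_mult:
  "Poly_Mapping.lookup (poly_var i * p) (Poly_Mapping.single i 1 + m) = Poly_Mapping.lookup p m"
proof -
  have "poly_var i * p =
      (\<Sum>l\<in>Poly_Mapping.keys p. Poly_Mapping.single (Poly_Mapping.single i 1 + l) (Poly_Mapping.lookup p l))"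
    by (subst (1) sum_monomials [of p]) (simp add: sum_distrib_left poly_var_def mult_single)
  then have "Poly_Mapping.lookup (poly_var i * p) (Poly_Mapping.single i 1 + m) =
      (\<Sum>l\<in>Poly_Mapping.keys p. Poly_Mapping.lookup p l when l = m)"
    by (simp add: lookup_sum lookup_single)
  also have "\<dots> = Poly_Mapping.lookup p m"
    by (cases "m \<in> Poly_Mapping.keys p") (auto simp: when_def in_keys_iff)
  finally show ?thesis .
qed

lemma keys_poly_var_mult:
  "Poly_Mapping.keys (poly_var i * p) = (+) (Poly_Mapping.single i 1) ` Poly_Mapping.keys p"
proof
  show "Poly_Mapping.keys (poly_var i * p) \<subseteq> (+) (Poly_Mapping.single i 1) ` Poly_Mapping.keys p"
    using keys_mult [of "poly_var i" p] by (auto simp: poly_var_def)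
  show "(+) (Poly_Mapping.single i 1) ` Poly_Mapping.keys p \<subseteq> Poly_Mapping.keys (poly_var i * p)"
    using lookup_poly_var_mult [of i p] by (auto simp: in_keys_iff)
qed

lemma keys_nat_add:
  "Poly_Mapping.keys (a + b :: 'a \<Rightarrow>\<^sub>0 nat) = Poly_Mapping.keys a \<union> Poly_Mapping.keys b"
  by (auto simp: in_keys_iff lookup_add)

lemma single_add_diff_single:
  fixes m :: "nat \<Rightarrow>\<^sub>0 nat"
  assumes "k \<le> Poly_Mapping.lookup m j"
  shows "Poly_Mapping.single j k + (m - Poly_Mapping.single j k) = m"
  by (rule poly_mapping_eqI) (use assms in \<open>auto simp: lookup_add lookup_minus lookup_single when_def\<close>)

lemma mpoly_ring_simps [simp]:
  "mult (mpoly_ring n) = (*)" "one (mpoly_ring n) = 1"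
  "zero (mpoly_ring n) = 0" "add (mpoly_ring n) = (+)"
  by (simp_all add: mpoly_ring_def)

lemma mem_mpoly_ring:
  "p \<in> carrier (mpoly_ring n) \<longleftrightarrow> (\<forall>m\<in>Poly_Mapping.keys p. Poly_Mapping.keys m \<subseteq> {1..n})"
  by (simp add: mpoly_ring_def)

lemma poly_var_closed: "i \<in> {1..n} \<Longrightarrow> poly_var i \<in> carrier (mpoly_ring n)"
  by (auto simp: mem_mpoly_ring poly_var_def)

lemma single_closed:
  "Poly_Mapping.keys m \<subseteq> {1..n} \<Longrightarrow> Poly_Mapping.single m c \<in> carrier (mpoly_ring n)"
  by (auto simp: mem_mpoly_ring)

lemma mpoly_ring_cring: "cring (mpoly_ring n :: 'k::field mpoly ring)"
proof (rule cringI)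
  have add: "p + q \<in> carrier (mpoly_ring n)"
    if "p \<in> carrier (mpoly_ring n)" "q \<in> carrier (mpoly_ring n)" for p q :: "'k mpoly"
    using that keys_add [of p q] unfolding mem_mpoly_ring by blast
  show "abelian_group (mpoly_ring n :: 'k mpoly ring)"
  proof (rule abelian_groupI; (simp add: add add.assoc add.commute)?)
    show "0 \<in> carrier (mpoly_ring n :: 'k mpoly ring)"
      by (simp add: mem_mpoly_ring)
    fix p :: "'k mpoly"
    assume "p \<in> carrier (mpoly_ring n)"
    then show "\<exists>q\<in>carrier (mpoly_ring n). p + q = 0"
      by (intro bexI [of _ "- p"]) (auto simp: mem_mpoly_ring in_keys_iff)
  qed
  have mult: "p * q \<in> carrier (mpoly_ring n)"
    if "p \<in> carrier (mpoly_ring n)" "q \<in> carrier (mpoly_ring n)" for p q :: "'k mpoly"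
    using that keys_mult [of p q] unfolding mem_mpoly_ring by (fastforce simp: keys_nat_add)
  show "Group.comm_monoid (mpoly_ring n :: 'k mpoly ring)"
    by (rule comm_monoidI) (use mult in \<open>auto simp: mult.assoc mult.commute\<close>, simp add: mem_mpoly_ring)
qed (simp add: distrib_right)

lemma finsum_mpoly_ring:
  fixes f :: "'i \<Rightarrow> 'k::field mpoly"
  assumes "\<And>i. i \<in> A \<Longrightarrow> f i \<in> carrier (mpoly_ring n)" "finite A"
  shows "finsum (mpoly_ring n) f A = (\<Sum>i\<in>A. f i)"
proof -
  interpret cring "mpoly_ring n :: 'k mpoly ring" by (rule mpoly_ring_cring)
  show ?thesis
    using \<open>finite A\<close> assms(1) by (induction) (auto simp: finsum_insert)
qed

lemma sum_mem_mpoly_ring: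
  fixes f :: "'i \<Rightarrow> 'k::field mpoly"
  assumes "\<And>i. i \<in> A \<Longrightarrow> f i \<in> carrier (mpoly_ring n)" "finite A"
  shows "(\<Sum>i\<in>A. f i) \<in> carrier (mpoly_ring n)"
proof -
  interpret cring "mpoly_ring n :: 'k mpoly ring" by (rule mpoly_ring_cring)
  show ?thesis
    using finsum_closed [of f A] finsum_mpoly_ring [OF assms] assms(1) by auto
qed

text \<open>A polynomial all of whose monomials involve a variable from \<open>S\<close> lies in the ideal
  \<open>(x\<^sub>j : j \<in> S)\<close>, with an explicit decomposition: choose such a variable \<open>\<phi> m\<close> in every
  monomial \<open>m\<close>, divide it out, and collect the quotients by the chosen variable.\<close>

lemma sum_of_var_multiples:
  assumes p: "p \<in> carrier (mpoly_ring n)"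
    and S: "\<And>m. m \<in> Poly_Mapping.keys p \<Longrightarrow> Poly_Mapping.keys m \<inter> S \<noteq> {}"
    and fin: "finite S"
  obtains q where "\<And>j. j \<in> S \<Longrightarrow> q j \<in> carrier (mpoly_ring n)" "p = (\<Sum>j\<in>S. poly_var j * q j)"
proof -
  define \<phi> where "\<phi> m = (SOME j. j \<in> Poly_Mapping.keys m \<inter> S)" for m :: "nat \<Rightarrow>\<^sub>0 nat"
  have \<phi>: "\<phi> m \<in> Poly_Mapping.keys m" "\<phi> m \<in> S" if "m \<in> Poly_Mapping.keys p" for m
    using S [OF that] someI_ex [of "\<lambda>j. j \<in> Poly_Mapping.keys m \<inter> S"]
    unfolding \<phi>_def by blast+
  define t where "t m = Poly_Mapping.single (m - Poly_Mapping.single (\<phi> m) 1) (Poly_Mapping.lookup p m)" for m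
  define q where "q j = (\<Sum>m\<in>{m\<in>Poly_Mapping.keys p. \<phi> m = j}. t m)" for j
  show thesis
  proof (rule that [of q])
    fix j
    have "t m \<in> carrier (mpoly_ring n)" if "m \<in> Poly_Mapping.keys p" for m
    proof -
      have "Poly_Mapping.keys (m - Poly_Mapping.single (\<phi> m) 1) \<subseteq> Poly_Mapping.keys m"
        by (auto simp: in_keys_iff lookup_minus)
      then show ?thesis
        using p that unfolding t_def mem_mpoly_ring by (intro single_closed[unfolded mem_mpoly_ring]) blast
    qed
    then show "q j \<in> carrier (mpoly_ring n)"
      unfolding q_def by (intro sum_mem_mpoly_ring) auto
  next
    have t: "poly_var (\<phi> m) * t m = Poly_Mapping.single m (Poly_Mapping.lookup p m)"
      if "m \<in> Poly_Mapping.keys p" for m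
    proof -
      have "1 \<le> Poly_Mapping.lookup m (\<phi> m)"
        using \<phi>(1) [OF that] by (simp add: in_keys_iff)
      from single_add_diff_single [OF this] show ?thesis
        by (simp add: t_def poly_var_def mult_single)
    qed
    have "p = (\<Sum>m\<in>Poly_Mapping.keys p. poly_var (\<phi> m) * t m)"
      by (subst sum_monomials) (simp add: t)
    also have "\<dots> = (\<Sum>j\<in>S. \<Sum>m\<in>{m\<in>Poly_Mapping.keys p. \<phi> m = j}. poly_var (\<phi> m) * t m)"
      by (rule sum.group [symmetric]) (use fin \<phi> in auto)
    also have "\<dots> = (\<Sum>j\<in>S. poly_var j * q j)"
      by (simp add: q_def sum_distrib_left)
    finally show "p = (\<Sum>j\<in>S. poly_var j * q j)" .
  qed
qed

section \<open>The monomial ideal of relations\<close>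

text \<open>The monomials that become zero in the quotient ring: the surviving ones are \<open>1\<close>, \<open>x\<^sub>1\<close> and the
  powers \<open>x\<^sub>i\<^sup>e\<close> with \<open>i \<ge> 2\<close>.\<close>

definition vanishing_monomial :: "(nat \<Rightarrow>\<^sub>0 nat) \<Rightarrow> bool"
  where "vanishing_monomial m \<longleftrightarrow> 2 \<le> Poly_Mapping.lookup m 1 \<or>
    (\<exists>i\<in>Poly_Mapping.keys m. \<exists>j\<in>Poly_Mapping.keys m. i \<noteq> j)"

lemma vanishing_monomial_add: "vanishing_monomial m \<Longrightarrow> vanishing_monomial (l + m)"
  by (fastforce simp: vanishing_monomial_def keys_nat_add lookup_add)

definition vanishing_polys :: "nat \<Rightarrow> 'k::field mpoly set"
  where "vanishing_polys n = {p \<in> carrier (mpoly_ring n). \<forall>m\<in>Poly_Mapping.keys p. vanishing_monomial m}"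

lemma vanishing_polys_ideal: "ideal (vanishing_polys n) (mpoly_ring n :: 'k::field mpoly ring)"
proof -
  interpret cring "mpoly_ring n :: 'k mpoly ring" by (rule mpoly_ring_cring)
  have inv: "\<ominus>\<^bsub>mpoly_ring n\<^esub> p = - p" if "p \<in> carrier (mpoly_ring n)" for p :: "'k mpoly"
    using that r_neg [OF that] by (simp add: eq_neg_iff_add_eq_0 add.commute)
  have lm: "p * q \<in> vanishing_polys n"
    if "p \<in> carrier (mpoly_ring n)" "q \<in> vanishing_polys n" for p q :: "'k mpoly"
  proof -
    have "vanishing_monomial m" if "m \<in> Poly_Mapping.keys (p * q)" for m
      using that keys_mult [of p q] \<open>q \<in> vanishing_polys n\<close> by (auto simp: vanishing_polys_def vanishing_monomial_add)
    moreover have "p * q \<in> carrier (mpoly_ring n)"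
      using that m_closed [of p q] by (simp add: vanishing_polys_def)
    ultimately show ?thesis by (simp add: vanishing_polys_def)
  qed
  show ?thesis
  proof (rule idealI)
    show "subgroup (vanishing_polys n) (add_monoid (mpoly_ring n :: 'k mpoly ring))"
    proof (rule add.subgroupI)
      show "vanishing_polys n \<noteq> ({} :: 'k mpoly set)"
        using zero_closed by (auto simp: vanishing_polys_def intro!: exI [of _ 0])
      fix p q :: "'k mpoly"
      assume p: "p \<in> vanishing_polys n"
      then show "\<ominus>\<^bsub>mpoly_ring n\<^esub> p \<in> vanishing_polys n"
        using a_inv_closed [of p] by (auto simp: inv vanishing_polys_def in_keys_iff)
      assume q: "q \<in> vanishing_polys n"
      show "p \<oplus>\<^bsub>mpoly_ring n\<^esub> q \<in> vanishing_polys n"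
        using p q a_closed [of p q] keys_add [of p q] by (auto simp: vanishing_polys_def)
    qed (auto simp: vanishing_polys_def)
      show "p \<otimes>\<^bsub>mpoly_ring n\<^esub> q \<in> vanishing_polys n" "q \<otimes>\<^bsub>mpoly_ring n\<^esub> p \<in> vanishing_polys n"
      if "p \<in> vanishing_polys n" "q \<in> carrier (mpoly_ring n)" for p q :: "'k mpoly"
      using lm [OF that(2,1)] by (simp_all add: mult.commute)
  qed (rule ring_axioms)
qed

lemma rel_gen_closed:
  assumes "1 \<le> n"
  shows "{poly_var 1 ^ 2} \<union> {poly_var i * poly_var j | i j. i \<in> {1..n} \<and> j \<in> {1..n} \<and> i \<noteq> j}
    \<subseteq> carrier (mpoly_ring n :: 'k::field mpoly ring)"
proof -
  interpret cring "mpoly_ring n :: 'k mpoly ring" by (rule mpoly_ring_cring)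
  have "poly_var i * poly_var j \<in> carrier (mpoly_ring n :: 'k mpoly ring)"
    if "i \<in> {1..n}" "j \<in> {1..n}" for i j
    using m_closed [OF poly_var_closed [OF that(1)] poly_var_closed [OF that(2)]] by simp
  then show ?thesis
    using assms by (auto simp: power2_eq_square)
qed

lemma rel_ideal_ideal:
  assumes "1 \<le> n"
  shows "ideal (rel_ideal n) (mpoly_ring n :: 'k::field mpoly ring)"
  unfolding rel_ideal_def
  by (rule ring.genideal_ideal [OF cring.axioms(1) [OF mpoly_ring_cring] rel_gen_closed [OF assms]])

text \<open>The relation ideal is a monomial ideal, so membership can be read off from the monomials of a
  polynomial. For the harder inclusion, each vanishing monomial is divisible by a generator:
  by \<open>x\<^sub>1\<^sup>2\<close> if \<open>x\<^sub>1\<close> has exponent at least 2, and by \<open>x\<^sub>i x\<^sub>j\<close> if it involves two variables.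
  All computations in the quotient ring rest on this lemma.\<close>

lemma rel_ideal_eq_vanishing_polys:
  assumes n: "1 \<le> n"
  shows "rel_ideal n = (vanishing_polys n :: 'k::field mpoly set)"
proof
  interpret P: cring "mpoly_ring n :: 'k mpoly ring" by (rule mpoly_ring_cring)
  interpret I: ideal "rel_ideal n" "mpoly_ring n :: 'k mpoly ring" by (rule rel_ideal_ideal [OF n])
  let ?G = "{poly_var 1 ^ 2} \<union> {poly_var i * poly_var j | i j. i \<in> {1..n} \<and> j \<in> {1..n} \<and> i \<noteq> j} :: 'k mpoly set"
  have gen: "?G \<subseteq> carrier (mpoly_ring n)"
    by (rule rel_gen_closed [OF n])
  have "vanishing_monomial (Poly_Mapping.single i 1 + Poly_Mapping.single j 1)" if "i \<noteq> j \<or> i = 1" for i j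
    using that by (auto simp: vanishing_monomial_def keys_nat_add lookup_add)
  then have "\<forall>m\<in>Poly_Mapping.keys p. vanishing_monomial m" if "p \<in> ?G" for p
    using that by (auto simp: poly_var_def mult_single power2_eq_square)
  then have "?G \<subseteq> vanishing_polys n"
    using gen unfolding vanishing_polys_def by blast
  then show "rel_ideal n \<subseteq> (vanishing_polys n :: 'k mpoly set)"
    unfolding rel_ideal_def by (rule P.genideal_minimal [OF vanishing_polys_ideal])
  have mono: "Poly_Mapping.single m c \<in> rel_ideal n"
    if "vanishing_monomial m" "Poly_Mapping.keys m \<subseteq> {1..n}" for m and c :: 'k
  proof -
    have factor: "Poly_Mapping.single m c \<in> rel_ideal n" if "g + l = m" "Poly_Mapping.single g 1 \<in> ?G" for g l
    proof -
      have "Poly_Mapping.single l c \<in> carrier (mpoly_ring n)"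
        using \<open>Poly_Mapping.keys m \<subseteq> {1..n}\<close> that(1) by (intro single_closed) (auto simp: keys_nat_add)
      moreover have "Poly_Mapping.single g 1 \<in> (rel_ideal n :: 'k mpoly set)"
        unfolding rel_ideal_def by (rule subsetD [OF P.genideal_self [OF gen] that(2)])
      ultimately show ?thesis
        using I.I_r_closed [of "Poly_Mapping.single g 1" "Poly_Mapping.single l c"] that(1)
        by (simp add: mult_single)
    qed
    from \<open>vanishing_monomial m\<close> consider "2 \<le> Poly_Mapping.lookup m 1"
      | i j where "i \<in> Poly_Mapping.keys m" "j \<in> Poly_Mapping.keys m" "i \<noteq> j"
      unfolding vanishing_monomial_def by blast
    then show ?thesis
    proof cases
      case 1
      have "Poly_Mapping.single (Poly_Mapping.single 1 2) 1 = (poly_var 1 ^ 2 :: 'k mpoly)"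
        by (simp add: poly_var_def power2_eq_square mult_single numeral_2_eq_2 flip: single_add)
      then show ?thesis
        by (intro factor [OF single_add_diff_single [OF 1]]) auto
    next
      case 2
      let ?g = "Poly_Mapping.single i 1 + Poly_Mapping.single j (1::nat)"
      have "?g + (m - ?g) = m"
        by (rule poly_mapping_eqI)
          (use 2 in \<open>auto simp: lookup_add lookup_minus lookup_single when_def in_keys_iff\<close>)
      moreover have "Poly_Mapping.single ?g 1 = (poly_var i * poly_var j :: 'k mpoly)"
        by (simp add: poly_var_def mult_single)
      moreover have "i \<in> {1..n}" "j \<in> {1..n}"
        using 2 \<open>Poly_Mapping.keys m \<subseteq> {1..n}\<close> by blast+
      ultimately show ?thesis
        using \<open>i \<noteq> j\<close> by (intro factor) auto
    qed
  qed
  show "(vanishing_polys n :: 'k mpoly set) \<subseteq> rel_ideal n"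
  proof
    fix p :: "'k mpoly"
    assume p: "p \<in> vanishing_polys n"
    have *: "Poly_Mapping.single m (Poly_Mapping.lookup p m) \<in> rel_ideal n" if "m \<in> Poly_Mapping.keys p" for m
      using p that by (intro mono) (auto simp: vanishing_polys_def mem_mpoly_ring)
    have "(\<Sum>m\<in>A. Poly_Mapping.single m (Poly_Mapping.lookup p m)) \<in> rel_ideal n"
      if "finite A" "A \<subseteq> Poly_Mapping.keys p" for A
      using that
    proof (induction A)
      case empty
      show ?case using I.zero_closed by simp
    next
      case (insert m A)
      then show ?case using I.a_closed [OF * [of m]] by simp
    qed
    from this [OF finite_keys subset_refl] show "p \<in> rel_ideal n"
      by (simp flip: sum_monomials)
  qed
qed

text \<open>A surviving monomial involves at most one variable. Hence one that occurs in \<open>x\<^sub>j p\<^sub>j\<close> occurs in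
  no other \<open>x\<^sub>l p\<^sub>l\<close>, and cannot cancel in the sum.\<close>

lemma var_multiple_of_sum_mem_rel_ideal:
  fixes p :: "nat \<Rightarrow> 'k::field mpoly"
  assumes n: "1 \<le> n" and S: "S \<subseteq> {1..n}"
    and p: "\<And>j. j \<in> S \<Longrightarrow> p j \<in> carrier (mpoly_ring n)"
    and sum: "(\<Sum>j\<in>S. poly_var j * p j) \<in> rel_ideal n"
    and j: "j \<in> S"
  shows "poly_var j * p j \<in> rel_ideal n"
proof -
  interpret P: cring "mpoly_ring n :: 'k mpoly ring" by (rule mpoly_ring_cring)
  have fin: "finite S" using S by (rule finite_subset) simp
  have keys: "l \<in> Poly_Mapping.keys m" if "m \<in> Poly_Mapping.keys (poly_var l * p l)" for m l
    using that by (auto simp: keys_poly_var_mult keys_nat_add)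
  have "vanishing_monomial m" if m: "m \<in> Poly_Mapping.keys (poly_var j * p j)" for m
  proof (rule ccontr)
    assume nonvanishing: "\<not> vanishing_monomial m"
    have "Poly_Mapping.lookup (poly_var l * p l) m = 0" if "l \<in> S - {j}" for l
    proof (rule ccontr)
      assume "Poly_Mapping.lookup (poly_var l * p l) m \<noteq> 0"
      then have "l \<in> Poly_Mapping.keys m"
        by (intro keys) (simp add: in_keys_iff)
      then show False
        using nonvanishing keys [OF m] that by (auto simp: vanishing_monomial_def)
    qed
    then have "Poly_Mapping.lookup (\<Sum>l\<in>S. poly_var l * p l) m = Poly_Mapping.lookup (poly_var j * p j) m"
      using fin j by (simp add: lookup_add lookup_sum sum.remove)
    then have "m \<in> Poly_Mapping.keys (\<Sum>l\<in>S. poly_var l * p l)"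
      using m by (simp add: in_keys_iff)
    then show False
      using sum nonvanishing n by (auto simp: rel_ideal_eq_vanishing_polys vanishing_polys_def)
  qed
  then show ?thesis
    using P.m_closed [OF poly_var_closed p, of j j] j S n
    by (auto simp: rel_ideal_eq_vanishing_polys vanishing_polys_def)
qed

text \<open>If \<open>m\<close> is a monomial of \<open>p\<close>, then \<open>x\<^sub>i m\<close> vanishes. Whether it does so because of \<open>x\<^sub>1\<^sup>2\<close> or because
  of two distinct variables, \<open>m\<close> must involve some \<open>x\<^sub>j\<close> with \<open>x\<^sub>i x\<^sub>j = 0\<close> in the quotient, so
  dividing such variables out of the monomials of \<open>p\<close> expresses \<open>p\<close> as required.\<close>

lemma annihilator_of_var_poly:
  fixes p :: "'k::field mpoly"
  assumes n: "1 \<le> n" and i: "i \<in> {1..n}"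
    and p: "p \<in> carrier (mpoly_ring n)" and ann: "poly_var i * p \<in> rel_ideal n"
  obtains q where
    "\<And>j. j \<in> {j\<in>{1..n}. poly_var i * poly_var j \<in> (rel_ideal n :: 'k mpoly set)} \<Longrightarrow>
      q j \<in> carrier (mpoly_ring n)"
    "p = (\<Sum>j\<in>{j\<in>{1..n}. poly_var i * poly_var j \<in> (rel_ideal n :: 'k mpoly set)}. poly_var j * q j)"
proof (rule sum_of_var_multiples [OF p])
  fix m assume m: "m \<in> Poly_Mapping.keys p"
  then have "vanishing_monomial (Poly_Mapping.single i 1 + m)"
    using ann n by (auto simp: rel_ideal_eq_vanishing_polys vanishing_polys_def keys_poly_var_mult)
  then have "\<exists>j\<in>Poly_Mapping.keys m. i = 1 \<and> j = 1 \<or> i \<noteq> j"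
    by (auto simp: vanishing_monomial_def keys_nat_add lookup_add lookup_single when_def in_keys_iff
        split: if_splits)
  then obtain j where j: "j \<in> Poly_Mapping.keys m" "i = 1 \<and> j = 1 \<or> i \<noteq> j"
    by blast
  have "j \<in> {1..n}"
    using p m j(1) unfolding mem_mpoly_ring by blast
  moreover have "vanishing_monomial (Poly_Mapping.single i 1 + Poly_Mapping.single j 1)"
    using j(2) by (auto simp: vanishing_monomial_def keys_nat_add lookup_add)
  ultimately have "poly_var i * poly_var j \<in> (rel_ideal n :: 'k mpoly set)"
    using n i by (auto simp: rel_ideal_eq_vanishing_polys vanishing_polys_def poly_var_def mult_single
        mem_mpoly_ring keys_nat_add)
  then show "Poly_Mapping.keys m \<inter>
      {j\<in>{1..n}. poly_var i * poly_var j \<in> (rel_ideal n :: 'k mpoly set)} \<noteq> {}"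
    using \<open>j \<in> {1..n}\<close> j(1) by blast
qed (use that in auto)

section \<open>Free modules and cyclic quotients\<close>

lemma free_module_on_simps [simp]:
  "zero (free_module_on R V) = (\<lambda>v\<in>V. \<zero>\<^bsub>R\<^esub>)"
  "f \<oplus>\<^bsub>free_module_on R V\<^esub> g = (\<lambda>v\<in>V. f v \<oplus>\<^bsub>R\<^esub> g v)"
  "a \<odot>\<^bsub>free_module_on R V\<^esub> f = (\<lambda>v\<in>V. a \<otimes>\<^bsub>R\<^esub> f v)"
  by (simp_all add: free_module_on_def)

lemma mem_free_module_on:
  "f \<in> carrier (free_module_on R V) \<longleftrightarrow> f \<in> V \<rightarrow>\<^sub>E carrier R \<and> finite {v\<in>V. f v \<noteq> \<zero>\<^bsub>R\<^esub>}"
  by (simp add: free_module_on_def)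

lemma free_module_onI:
  assumes "f \<in> V \<rightarrow>\<^sub>E carrier R" "finite S" "\<And>v. v \<in> V \<Longrightarrow> v \<notin> S \<Longrightarrow> f v = \<zero>\<^bsub>R\<^esub>"
  shows "f \<in> carrier (free_module_on R V)"
proof -
  have "{v\<in>V. f v \<noteq> \<zero>\<^bsub>R\<^esub>} \<subseteq> S"
    using assms(3) by blast
  from finite_subset [OF this assms(2)] show ?thesis
    using assms(1) by (simp add: mem_free_module_on)
qed

lemma (in cring) free_module_on_module: "module R (free_module_on R V)"
proof (rule moduleI)
  let ?F = "free_module_on R V"
  let ?supp = "\<lambda>f. {v\<in>V. f v \<noteq> \<zero>}"
  show "abelian_group ?F"
  proof (rule abelian_groupI)
    fix f g assume fg: "f \<in> carrier ?F" "g \<in> carrier ?F"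
    show "f \<oplus>\<^bsub>?F\<^esub> g \<in> carrier ?F"
      by (rule free_module_onI [where S = "?supp f \<union> ?supp g"])
        (use fg in \<open>auto simp: mem_free_module_on\<close>)
    show "f \<oplus>\<^bsub>?F\<^esub> g = g \<oplus>\<^bsub>?F\<^esub> f"
      using fg by (auto simp: mem_free_module_on PiE_iff a_comm intro!: restrict_ext)
  next
    show "\<zero>\<^bsub>?F\<^esub> \<in> carrier ?F"
      by (rule free_module_onI [where S = "{}"]) auto
  next
    fix f assume f: "f \<in> carrier ?F"
    have "(\<lambda>v\<in>V. \<ominus> f v) \<in> carrier ?F"
      by (rule free_module_onI [where S = "?supp f"]) (use f in \<open>auto simp: mem_free_module_on\<close>)
    moreover have "(\<lambda>v\<in>V. \<ominus> f v) \<oplus>\<^bsub>?F\<^esub> f = \<zero>\<^bsub>?F\<^esub>"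
      using f by (auto simp: mem_free_module_on PiE_iff l_neg intro!: restrict_ext)
    ultimately show "\<exists>g\<in>carrier ?F. g \<oplus>\<^bsub>?F\<^esub> f = \<zero>\<^bsub>?F\<^esub>"
      by blast
    show "\<zero>\<^bsub>?F\<^esub> \<oplus>\<^bsub>?F\<^esub> f = f"
      by (rule extensionalityI [where A = V]) (use f in \<open>auto simp: mem_free_module_on PiE_iff\<close>)
  next
    fix f g h assume "f \<in> carrier ?F" "g \<in> carrier ?F" "h \<in> carrier ?F"
    then show "f \<oplus>\<^bsub>?F\<^esub> g \<oplus>\<^bsub>?F\<^esub> h = f \<oplus>\<^bsub>?F\<^esub> (g \<oplus>\<^bsub>?F\<^esub> h)"
      by (auto simp: mem_free_module_on PiE_iff a_assoc intro!: restrict_ext)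
  qed
  fix a f assume a: "a \<in> carrier R" and f: "f \<in> carrier ?F"
  show "a \<odot>\<^bsub>?F\<^esub> f \<in> carrier ?F"
    by (rule free_module_onI [where S = "?supp f"]) (use a f in \<open>auto simp: mem_free_module_on\<close>)
next
  fix f assume "f \<in> carrier (free_module_on R V)"
  then show "\<one> \<odot>\<^bsub>free_module_on R V\<^esub> f = f"
    by (intro extensionalityI [where A = V]) (auto simp: mem_free_module_on PiE_iff)
qed (rule is_cring | auto simp: mem_free_module_on PiE_iff l_distr r_distr m_assoc intro!: restrict_ext)+

lemma (in cring) finsum_free_module_on:
  assumes "finite A" "\<And>b. b \<in> A \<Longrightarrow> g b \<in> carrier (free_module_on R V)"
  shows "(\<Oplus>\<^bsub>free_module_on R V\<^esub>b\<in>A. g b) = (\<lambda>v\<in>V. \<Oplus>b\<in>A. g b v)"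
proof -
  interpret F: module R "free_module_on R V" by (rule free_module_on_module)
  show ?thesis
    using assms
  proof (induction A)
    case (insert b A)
    have [simp]: "g c v \<in> carrier R" if "c \<in> insert b A" "v \<in> V" for c v
      using insert.prems [OF that(1)] that(2) by (auto simp: mem_free_module_on)
    show ?case
      using insert by (subst F.finsum_insert) (auto simp: finsum_insert Pi_def intro!: restrict_ext)
  qed simp
qed

definition unit_vector :: "('a, 'm) ring_scheme \<Rightarrow> 'v set \<Rightarrow> 'v \<Rightarrow> 'v \<Rightarrow> 'a"
  where "unit_vector R V u = (\<lambda>v\<in>V. if v = u then \<one>\<^bsub>R\<^esub> else \<zero>\<^bsub>R\<^esub>)"

lemma (in cring) unit_vector_closed: "unit_vector R V u \<in> carrier (free_module_on R V)"
proof -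
  have "finite {v\<in>V. unit_vector R V u v \<noteq> \<zero>}"
    by (rule finite_subset [of _ "{u}"]) (auto simp: unit_vector_def)
  then show ?thesis
    by (auto simp: mem_free_module_on unit_vector_def)
qed

text \<open>The basis consists of the unit vectors. Nontriviality of the ring keeps the unit vectors of
  different positions apart, so that the coefficient of a vector at each of them is well defined.\<close>

lemma (in cring) free_module_on_free:
  assumes nontrivial: "\<one> \<noteq> \<zero>"
  shows "free_module R (free_module_on R V)"
proof -
  let ?F = "free_module_on R V"
  let ?B = "unit_vector R V ` V"
  interpret F: module R ?F by (rule free_module_on_module)
  have inj: "unit_vector R V u = unit_vector R V v \<longleftrightarrow> u = v" if "u \<in> V" "v \<in> V" for u v
  proof
    assume "unit_vector R V u = unit_vector R V v"
    then have "unit_vector R V u u = unit_vector R V v u"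
      by simp
    then show "u = v"
      using that nontrivial by (simp add: unit_vector_def split: if_splits)
  qed simp
  have expand: "(\<Oplus>\<^bsub>?F\<^esub>b\<in>{b\<in>?B. c b \<noteq> \<zero>}. c b \<odot>\<^bsub>?F\<^esub> b) = (\<lambda>v\<in>V. c (unit_vector R V v))"
    if c: "c \<in> ?B \<rightarrow>\<^sub>E carrier R" and fin: "finite {b\<in>?B. c b \<noteq> \<zero>}" for c
  proof -
    let ?A = "{b\<in>?B. c b \<noteq> \<zero>}"
    have cc: "c b \<in> carrier R" "b \<in> carrier ?F" if "b \<in> ?B" for b
      using that c unit_vector_closed by auto
    have "(\<Oplus>b\<in>?A. (c b \<odot>\<^bsub>?F\<^esub> b) v) = c (unit_vector R V v)" if v: "v \<in> V" for v
    proof -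
      have "(\<Oplus>b\<in>?A. (c b \<odot>\<^bsub>?F\<^esub> b) v) = (\<Oplus>b\<in>?A. if unit_vector R V v = b then c b else \<zero>)"
        using v cc by (intro finsum_cong') (auto simp: unit_vector_def inj [unfolded unit_vector_def])
      also have "\<dots> = c (unit_vector R V v)"
      proof (cases "c (unit_vector R V v) = \<zero>")
        case True
        then show ?thesis by (intro trans [OF add.finprod_one_eqI]) auto
      next
        case False
        then show ?thesis using v fin cc by (intro finsum_singleton) auto
      qed
      finally show ?thesis .
    qed
    moreover have "(\<Oplus>\<^bsub>?F\<^esub>b\<in>?A. c b \<odot>\<^bsub>?F\<^esub> b) = (\<lambda>v\<in>V. \<Oplus>b\<in>?A. (c b \<odot>\<^bsub>?F\<^esub> b) v)"
      using fin cc by (intro finsum_free_module_on F.smult_closed) auto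
    ultimately show ?thesis
      by (auto intro!: restrict_ext)
  qed
  have "module_basis R ?F ?B"
    unfolding module_basis_def
  proof (intro conjI ballI)
    show "?B \<subseteq> carrier ?F"
      using unit_vector_closed by auto
    fix f assume f: "f \<in> carrier ?F"
    define c where "c = (\<lambda>b\<in>?B. f (inv_into V (unit_vector R V) b))"
    have c: "c (unit_vector R V v) = f v" if "v \<in> V" for v
      using that inj by (simp add: c_def inj_on_def inv_into_f_f)
    show "\<exists>!c. c \<in> ?B \<rightarrow>\<^sub>E carrier R \<and> finite {b\<in>?B. c b \<noteq> \<zero>} \<and>
        f = (\<Oplus>\<^bsub>?F\<^esub>b\<in>{b\<in>?B. c b \<noteq> \<zero>}. c b \<odot>\<^bsub>?F\<^esub> b)"
    proof (rule ex1I [of _ c])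
      have "c \<in> ?B \<rightarrow>\<^sub>E carrier R"
        using f c by (auto simp: mem_free_module_on) (auto simp: c_def)
      moreover have "{b\<in>?B. c b \<noteq> \<zero>} = unit_vector R V ` {v\<in>V. f v \<noteq> \<zero>}"
        using c by auto
      then have "finite {b\<in>?B. c b \<noteq> \<zero>}"
        using f by (simp add: mem_free_module_on)
      moreover have "f = (\<lambda>v\<in>V. c (unit_vector R V v))"
        using f c by (auto simp: mem_free_module_on PiE_iff extensional_def)
      ultimately show "c \<in> ?B \<rightarrow>\<^sub>E carrier R \<and> finite {b\<in>?B. c b \<noteq> \<zero>} \<and>
          f = (\<Oplus>\<^bsub>?F\<^esub>b\<in>{b\<in>?B. c b \<noteq> \<zero>}. c b \<odot>\<^bsub>?F\<^esub> b)"
        using expand [of c] by simp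
    next
      fix c' assume c': "c' \<in> ?B \<rightarrow>\<^sub>E carrier R \<and> finite {b\<in>?B. c' b \<noteq> \<zero>} \<and>
          f = (\<Oplus>\<^bsub>?F\<^esub>b\<in>{b\<in>?B. c' b \<noteq> \<zero>}. c' b \<odot>\<^bsub>?F\<^esub> b)"
      then have "f = (\<lambda>v\<in>V. c' (unit_vector R V v))"
        using expand [of c'] by simp
      then have "c' (unit_vector R V v) = c (unit_vector R V v)" if "v \<in> V" for v
        using that c by simp
      then have "c' b = c b" if "b \<in> ?B" for b
        using that by auto
      moreover have "c' b = c b" if "b \<notin> ?B" for b
        using that c' by (auto simp: c_def PiE_iff extensional_def)
      ultimately show "c' = c" by blast
    qed
  qed
  then show ?thesis
    unfolding free_module_def using F.module_axioms by blast
qed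

lemma (in cring) quotient_module_module:
  assumes "ideal J R"
  shows "module R (quotient_module R J)"
proof -
  interpret J: ideal J R by fact
  interpret Q: cring "R Quot J" by (rule J.quotient_is_cring [OF is_cring])
  interpret h: ring_hom_cring R "R Quot J" "(+>) J" by (rule J.rcos_ring_hom_cring [OF is_cring])
  have simps: "carrier (quotient_module R J) = carrier (R Quot J)"
    "add (quotient_module R J) = add (R Quot J)"
    "zero (quotient_module R J) = zero (R Quot J)"
    "smult (quotient_module R J) = (\<lambda>a X. (J +> a) \<otimes>\<^bsub>R Quot J\<^esub> X)"
    by (simp_all add: quotient_module_def)
  have "abelian_group (quotient_module R J)"
    by (rule abelian_groupI)
      (simp_all add: simps Q.add.m_assoc Q.add.m_comm Q.add.m_lcomm)
  then show ?thesis
    by (intro moduleI is_cring)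
      (simp_all add: simps Q.l_distr Q.r_distr Q.m_assoc)
qed

section \<open>Annihilators in the base ring\<close>

lemma base_ring_cring:
  assumes "1 \<le> n"
  shows "cring (base_ring n :: 'k::field mpoly set ring)"
  unfolding base_ring_def
  by (rule ideal.quotient_is_cring [OF rel_ideal_ideal [OF assms] mpoly_ring_cring])

lemma coset_map_hom:
  assumes "1 \<le> n"
  shows "ring_hom_cring (mpoly_ring n) (base_ring n :: 'k::field mpoly set ring)
    ((+>\<^bsub>mpoly_ring n\<^esub>) (rel_ideal n))"
  unfolding base_ring_def
  by (rule ideal.rcos_ring_hom_cring [OF rel_ideal_ideal [OF assms] mpoly_ring_cring])

lemma carrier_base_ring:
  "carrier (base_ring n) = (+>\<^bsub>mpoly_ring n\<^esub>) (rel_ideal n) ` carrier (mpoly_ring n)"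
  unfolding base_ring_def FactRing_def A_RCOSETS_def RCOSETS_def a_r_coset_def by auto

lemma base_ring_elem:
  assumes "r \<in> carrier (base_ring n)"
  obtains p where "p \<in> carrier (mpoly_ring n)" "r = rel_ideal n +>\<^bsub>mpoly_ring n\<^esub> p"
  using assms by (auto simp: carrier_base_ring)

lemma coset_eq_zero_iff:
  fixes p :: "'k::field mpoly"
  assumes "1 \<le> n" "p \<in> carrier (mpoly_ring n)"
  shows "rel_ideal n +>\<^bsub>mpoly_ring n\<^esub> p = \<zero>\<^bsub>base_ring n\<^esub> \<longleftrightarrow> p \<in> rel_ideal n"
proof -
  interpret P: cring "mpoly_ring n :: 'k mpoly ring" by (rule mpoly_ring_cring)
  interpret I: ideal "rel_ideal n" "mpoly_ring n :: 'k mpoly ring" by (rule rel_ideal_ideal [OF assms(1)])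
  show ?thesis
    using assms(2) I.rcos_const_imp_mem I.a_rcos_const by (auto simp: base_ring_def FactRing_def)
qed

lemma ring_var_closed: "i \<in> {1..n} \<Longrightarrow> ring_var n i \<in> carrier (base_ring n)"
  unfolding ring_var_def carrier_base_ring by (intro imageI poly_var_closed)

lemma base_ring_nontrivial:
  assumes "1 \<le> n"
  shows "\<one>\<^bsub>base_ring n\<^esub> \<noteq> (\<zero>\<^bsub>base_ring n\<^esub> :: 'k::field mpoly set)"
proof -
  have "(1 :: 'k mpoly) \<notin> rel_ideal n"
    using assms by (simp add: rel_ideal_eq_vanishing_polys vanishing_polys_def vanishing_monomial_def)
  moreover have "(1 :: 'k mpoly) \<in> carrier (mpoly_ring n)"
    by (simp add: mem_mpoly_ring)
  moreover have "\<one>\<^bsub>base_ring n\<^esub> = rel_ideal n +>\<^bsub>mpoly_ring n\<^esub> (1 :: 'k mpoly)"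
    by (simp add: base_ring_def FactRing_def)
  ultimately show ?thesis
    using assms coset_eq_zero_iff by metis
qed

lemma ring_var_mult_eq_zero_iff:
  assumes n: "1 \<le> n" and "i \<in> {1..n}" "j \<in> {1..n}"
  shows "ring_var n i \<otimes>\<^bsub>base_ring n\<^esub> ring_var n j = (\<zero>\<^bsub>base_ring n\<^esub> :: 'k::field mpoly set)
    \<longleftrightarrow> poly_var i * poly_var j \<in> (rel_ideal n :: 'k mpoly set)"
proof -
  interpret h: ring_hom_cring "mpoly_ring n" "base_ring n :: 'k mpoly set ring"
    "(+>\<^bsub>mpoly_ring n\<^esub>) (rel_ideal n)"
    by (rule coset_map_hom [OF n])
  have X: "poly_var i \<in> carrier (mpoly_ring n :: 'k mpoly ring)"
    "poly_var j \<in> carrier (mpoly_ring n :: 'k mpoly ring)"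
    using assms poly_var_closed by blast+
  show ?thesis
    using h.hom_mult [OF X] coset_eq_zero_iff [OF n h.R.m_closed [OF X]] by (simp add: ring_var_def)
qed

lemma coset_sum_var_multiples:
  fixes q :: "nat \<Rightarrow> 'k::field mpoly"
  assumes n: "1 \<le> n" and S: "S \<subseteq> {1..n}"
    and q: "\<And>j. j \<in> S \<Longrightarrow> q j \<in> carrier (mpoly_ring n)"
  shows "(\<Oplus>\<^bsub>base_ring n\<^esub>j\<in>S. ring_var n j \<otimes>\<^bsub>base_ring n\<^esub> (rel_ideal n +>\<^bsub>mpoly_ring n\<^esub> q j))
    = rel_ideal n +>\<^bsub>mpoly_ring n\<^esub> (\<Sum>j\<in>S. poly_var j * q j)"
proof -
  interpret h: ring_hom_cring "mpoly_ring n" "base_ring n :: 'k mpoly set ring"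
    "(+>\<^bsub>mpoly_ring n\<^esub>) (rel_ideal n)"
    by (rule coset_map_hom [OF n])
  have X: "poly_var j \<in> carrier (mpoly_ring n :: 'k mpoly ring)" if "j \<in> S" for j
    using S that poly_var_closed by blast
  have Xq: "poly_var j * q j \<in> carrier (mpoly_ring n)" if "j \<in> S" for j
    using h.R.m_closed [OF X q, of j j] that by simp
  have "rel_ideal n +>\<^bsub>mpoly_ring n\<^esub> (\<Sum>j\<in>S. poly_var j * q j) =
      rel_ideal n +>\<^bsub>mpoly_ring n\<^esub> (\<Oplus>\<^bsub>mpoly_ring n\<^esub>j\<in>S. poly_var j * q j)"
    by (subst finsum_mpoly_ring) (use Xq S finite_subset in auto)
  also have "\<dots> = (\<Oplus>\<^bsub>base_ring n\<^esub>j\<in>S. rel_ideal n +>\<^bsub>mpoly_ring n\<^esub> (poly_var j * q j))"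
    using Xq by (subst h.hom_finsum) (auto simp: comp_def)
  also have "\<dots> = (\<Oplus>\<^bsub>base_ring n\<^esub>j\<in>S.
      ring_var n j \<otimes>\<^bsub>base_ring n\<^esub> (rel_ideal n +>\<^bsub>mpoly_ring n\<^esub> q j))"
    using X q h.hom_mult [OF X q] by (intro h.S.finsum_cong') (auto simp: ring_var_def)
  finally show ?thesis by simp
qed

text \<open>The maximal ideal \<open>(x\<^sub>1, \<dots>, x\<^sub>n)\<close> of the ring is the direct sum of the principal ideals \<open>(x\<^sub>j)\<close>.
  This decouples the conditions under which the differential vanishes: they can be checked one
  vertex at a time.\<close>

lemma ring_var_multiples_independent:
  fixes a :: "nat \<Rightarrow> 'k::field mpoly set"
  assumes n: "1 \<le> n" and S: "S \<subseteq> {1..n}"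
    and a: "\<And>j. j \<in> S \<Longrightarrow> a j \<in> carrier (base_ring n)"
    and sum: "(\<Oplus>\<^bsub>base_ring n\<^esub>j\<in>S. ring_var n j \<otimes>\<^bsub>base_ring n\<^esub> a j) = \<zero>\<^bsub>base_ring n\<^esub>"
    and j: "j \<in> S"
  shows "ring_var n j \<otimes>\<^bsub>base_ring n\<^esub> a j = \<zero>\<^bsub>base_ring n\<^esub>"
proof -
  interpret h: ring_hom_cring "mpoly_ring n" "base_ring n :: 'k mpoly set ring"
    "(+>\<^bsub>mpoly_ring n\<^esub>) (rel_ideal n)"
    by (rule coset_map_hom [OF n])
  have "\<forall>j\<in>S. \<exists>p. p \<in> carrier (mpoly_ring n) \<and> a j = rel_ideal n +>\<^bsub>mpoly_ring n\<^esub> p"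
    using a base_ring_elem by metis
  then obtain p where p: "\<And>j. j \<in> S \<Longrightarrow> p j \<in> carrier (mpoly_ring n)"
    and ap: "\<And>j. j \<in> S \<Longrightarrow> a j = rel_ideal n +>\<^bsub>mpoly_ring n\<^esub> p j"
    by metis
  have X: "poly_var j \<in> carrier (mpoly_ring n :: 'k mpoly ring)" if "j \<in> S" for j
    using S that poly_var_closed by blast
  have Xp: "poly_var j * p j \<in> carrier (mpoly_ring n)" if "j \<in> S" for j
    using h.R.m_closed [OF X p, of j j] that by simp
  have "(\<Oplus>\<^bsub>base_ring n\<^esub>j\<in>S. ring_var n j \<otimes>\<^bsub>base_ring n\<^esub> a j) =
      (\<Oplus>\<^bsub>base_ring n\<^esub>j\<in>S. ring_var n j \<otimes>\<^bsub>base_ring n\<^esub> (rel_ideal n +>\<^bsub>mpoly_ring n\<^esub> p j))"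
  proof (rule h.S.finsum_cong')
    show "(\<lambda>j. ring_var n j \<otimes>\<^bsub>base_ring n\<^esub> (rel_ideal n +>\<^bsub>mpoly_ring n\<^esub> p j)) \<in> S \<rightarrow> carrier (base_ring n)"
      using X p by (auto simp: ring_var_def)
  qed (simp_all add: ap)
  then have "rel_ideal n +>\<^bsub>mpoly_ring n\<^esub> (\<Sum>j\<in>S. poly_var j * p j) = \<zero>\<^bsub>base_ring n\<^esub>"
    using sum coset_sum_var_multiples [OF n S p] by simp
  moreover have "(\<Sum>j\<in>S. poly_var j * p j) \<in> carrier (mpoly_ring n)"
    by (rule sum_mem_mpoly_ring) (use Xp S finite_subset in auto)
  ultimately have "(\<Sum>j\<in>S. poly_var j * p j) \<in> rel_ideal n"
    using coset_eq_zero_iff [OF n] by blast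
  from var_multiple_of_sum_mem_rel_ideal [OF n S p this j]
  have "rel_ideal n +>\<^bsub>mpoly_ring n\<^esub> (poly_var j * p j) = \<zero>\<^bsub>base_ring n\<^esub>"
    using coset_eq_zero_iff [OF n Xp [OF j]] by blast
  then show ?thesis
    using h.hom_mult [OF X p, OF j j] by (simp add: ring_var_def ap [OF j])
qed

text \<open>The annihilator of \<open>x\<^sub>i\<close> is generated by the variables that kill \<open>x\<^sub>i\<close>, which are exactly
  the labels that the construction procedure attaches above an arrow with label \<open>i\<close>. The
  coefficients are total functions of the index so that they can be chosen for all vertices
  at once.\<close>

lemma annihilator_of_ring_var:
  fixes a :: "'k::field mpoly set"
  assumes n: "1 \<le> n" and i: "i \<in> {1..n}" and a: "a \<in> carrier (base_ring n)"
    and ann: "ring_var n i \<otimes>\<^bsub>base_ring n\<^esub> a = \<zero>\<^bsub>base_ring n\<^esub>"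
  obtains r where "\<And>j. r j \<in> carrier (base_ring n)"
    "a = (\<Oplus>\<^bsub>base_ring n\<^esub>j\<in>{j\<in>{1..n}. poly_var i * poly_var j \<in> (rel_ideal n :: 'k mpoly set)}.
       ring_var n j \<otimes>\<^bsub>base_ring n\<^esub> r j)"
proof -
  interpret h: ring_hom_cring "mpoly_ring n" "base_ring n :: 'k mpoly set ring"
    "(+>\<^bsub>mpoly_ring n\<^esub>) (rel_ideal n)"
    by (rule coset_map_hom [OF n])
  let ?S = "{j\<in>{1..n}. poly_var i * poly_var j \<in> (rel_ideal n :: 'k mpoly set)}"
  obtain p where p: "p \<in> carrier (mpoly_ring n)" and ap: "a = rel_ideal n +>\<^bsub>mpoly_ring n\<^esub> p"
    using base_ring_elem [OF a] .
  have X: "poly_var i \<in> carrier (mpoly_ring n :: 'k mpoly ring)"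
    using i by (rule poly_var_closed)
  have "rel_ideal n +>\<^bsub>mpoly_ring n\<^esub> (poly_var i * p) = \<zero>\<^bsub>base_ring n\<^esub>"
    using ann h.hom_mult [OF X p] by (simp add: ap ring_var_def)
  then have "poly_var i * p \<in> rel_ideal n"
    using coset_eq_zero_iff [OF n h.R.m_closed [OF X p]] by simp
  from annihilator_of_var_poly [OF n i p this] obtain q
    where q: "\<And>j. j \<in> ?S \<Longrightarrow> q j \<in> carrier (mpoly_ring n)" and pq: "p = (\<Sum>j\<in>?S. poly_var j * q j)"
    by blast
  \<comment> \<open>Only the values of \<open>q\<close> on the admissible indices are known to lie in the ring.\<close>
  define q' where "q' j = (if j \<in> ?S then q j else 0)" for j
  have q': "q' j \<in> carrier (mpoly_ring n)" for j
    using q h.R.zero_closed by (simp add: q'_def)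
  have "p = (\<Sum>j\<in>?S. poly_var j * q' j)"
    unfolding pq by (rule sum.cong) (auto simp: q'_def)
  then have "a = (\<Oplus>\<^bsub>base_ring n\<^esub>j\<in>?S. ring_var n j \<otimes>\<^bsub>base_ring n\<^esub> (rel_ideal n +>\<^bsub>mpoly_ring n\<^esub> q' j))"
    unfolding ap by (subst coset_sum_var_multiples [OF n _ q']) auto
  then show thesis
    by (rule that [OF h.hom_closed [OF q']])
qed

section \<open>The differential\<close>

lemma arrowsD:
  assumes "(v, i, w) \<in> arrows I n d" "1 \<le> n"
  shows "v = i # w" "i \<in> {1..n}" "w \<in> vertices I n d"
proof -
  have "v = i # w \<and> i \<in> {1..n} \<and> w \<in> vertices I n d"
    using assms by (cases d) auto
  then show "v = i # w" "i \<in> {1..n}" "w \<in> vertices I n d" by auto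
qed

lemma Cons_mem_vertices_iff:
  assumes "1 \<le> n"
  shows "j # w \<in> vertices I n (Suc d) \<longleftrightarrow> (j # w, j, w) \<in> arrows I n d"
  using arrowsD(1) [OF _ assms, of "j # w" _ _ I d] by auto

lemma vertices_SucE:
  assumes "v \<in> vertices I n (Suc d)" "1 \<le> n"
  obtains j w where "v = j # w" "j \<in> {1..n}" "w \<in> vertices I n d"
proof -
  obtain j w where "(v, j, w) \<in> arrows I n d"
    using assms(1) by auto
  from arrowsD [OF this assms(2)] show thesis
    by (rule that)
qed

text \<open>A vertex \<open>i # w\<close> has a single outgoing arrow, and that arrow has label \<open>i\<close>. So the label \<open>i\<close>
  alone decides which vertices are added above it.\<close>

lemma Cons_Cons_mem_vertices_iff:
  assumes "1 \<le> n" "i # w \<in> vertices I n (Suc d)"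
  shows "j # i # w \<in> vertices I n (Suc (Suc d)) \<longleftrightarrow>
    j \<in> {1..n} \<and> poly_var i * poly_var j \<in> I"
proof -
  have "(i # w, i', w') \<in> arrows I n d \<longleftrightarrow> i' = i \<and> w' = w" for i' w'
    using assms arrowsD(1) [of "i # w" i' w' I n d] Cons_mem_vertices_iff [of n i w I d] by auto
  then show ?thesis
    using assms(1) by (simp only: Cons_mem_vertices_iff arrows.simps) auto
qed

lemma finite_vertices: "1 \<le> n \<Longrightarrow> finite (vertices I n d)"
proof (induction d)
  case (Suc d)
  have "vertices I n (Suc d) \<subseteq> (\<lambda>(j, w). j # w) ` ({1..n} \<times> vertices I n d)"
  proof
    fix v assume "v \<in> vertices I n (Suc d)"
    then obtain j w where "v = j # w" "j \<in> {1..n}" "w \<in> vertices I n d"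
      using Suc.prems by (rule vertices_SucE)
    then show "v \<in> (\<lambda>(j, w). j # w) ` ({1..n} \<times> vertices I n d)"
      by auto
  qed
  with Suc show ?case
    using finite_subset by blast
qed simp

lemma mem_chain_module:
  assumes "1 \<le> n"
  shows "f \<in> carrier (chain_module n d :: ('k::field mpoly set, vertex \<Rightarrow> 'k mpoly set) module) \<longleftrightarrow>
    f \<in> vertices (rel_ideal n :: 'k mpoly set) n d \<rightarrow>\<^sub>E carrier (base_ring n)"
  by (auto simp: chain_module_def mem_free_module_on
      intro: finite_subset [OF _ finite_vertices [OF assms]])

text \<open>The labels of the arrows that end in \<open>w\<close>, for a vertex \<open>w\<close> of degree \<open>d\<close>.\<close>

definition out_labels :: "'k::field mpoly set \<Rightarrow> nat \<Rightarrow> nat \<Rightarrow> vertex \<Rightarrow> nat set"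
  where "out_labels I n d w = {j. j # w \<in> vertices I n (Suc d)}"

lemma out_labels_subset:
  assumes "1 \<le> n"
  shows "out_labels I n d w \<subseteq> {1..n}"
  using arrowsD(2) [OF _ assms] unfolding out_labels_def Cons_mem_vertices_iff [OF assms] by blast

text \<open>The matrix of the differential is sparse: nonzero entries in the row of \<open>w\<close> occur only at the
  vertices \<open>j # w\<close>. Distinct rows thus involve disjoint sets of components of \<open>f\<close>.\<close>

lemma chain_diff_apply:
  fixes f :: "vertex \<Rightarrow> 'k::field mpoly set"
  assumes n: "1 \<le> n" and f: "f \<in> carrier (chain_module n (Suc d))"
    and w: "w \<in> vertices (rel_ideal n :: 'k mpoly set) n d"
  shows "chain_diff n d f w =
    (\<Oplus>\<^bsub>base_ring n\<^esub>j\<in>out_labels (rel_ideal n :: 'k mpoly set) n d w.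
       ring_var n j \<otimes>\<^bsub>base_ring n\<^esub> f (j # w))"
proof -
  interpret R: cring "base_ring n :: 'k mpoly set ring" by (rule base_ring_cring [OF n])
  let ?I = "rel_ideal n :: 'k mpoly set"
  let ?V = "vertices ?I n (Suc d)"
  let ?L = "out_labels ?I n d w"
  have entry: "diff_entry n d (j # u) w = (if u = w then ring_var n j else \<zero>\<^bsub>base_ring n\<^esub> :: 'k mpoly set)"
    if "j # u \<in> ?V" for j u
  proof -
    have "(j # u, i, w) \<in> arrows ?I n d \<longleftrightarrow> i = j \<and> u = w" for i
      using that arrowsD(1) [OF _ n, of "j # u" i w ?I d] Cons_mem_vertices_iff [OF n, of j u ?I d] by auto
    then show ?thesis
      by (cases "u = w") (simp_all add: diff_entry_def)
  qed
  have fV: "f v \<in> carrier (base_ring n)" if "v \<in> ?V" for v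
    using f that n by (auto simp: mem_chain_module)
  have x: "ring_var n j \<in> carrier (base_ring n :: 'k mpoly set ring)" if "j # u \<in> ?V" for j u
    using vertices_SucE [OF that n] by (metis list.inject ring_var_closed)
  have closed: "diff_entry n d v w \<otimes>\<^bsub>base_ring n\<^esub> f v \<in> carrier (base_ring n)" if v: "v \<in> ?V" for v
  proof -
    obtain j u where "v = j # u"
      using vertices_SucE [OF v n] by metis
    then show ?thesis
      using v fV x entry by auto
  qed
  have "chain_diff n d f w = (\<Oplus>\<^bsub>base_ring n\<^esub>v\<in>?V. diff_entry n d v w \<otimes>\<^bsub>base_ring n\<^esub> f v)"
    using w by (simp add: chain_diff_def)
  also have "\<dots> = (\<Oplus>\<^bsub>base_ring n\<^esub>v\<in>(\<lambda>j. j # w) ` ?L. diff_entry n d v w \<otimes>\<^bsub>base_ring n\<^esub> f v)"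
  proof (rule R.add.finprod_mono_neutral_cong_right)
    show "finite ?V"
      by (rule finite_vertices [OF n])
    show "(\<lambda>j. j # w) ` ?L \<subseteq> ?V"
      by (auto simp: out_labels_def)
    show "diff_entry n d v w \<otimes>\<^bsub>base_ring n\<^esub> f v = \<zero>\<^bsub>base_ring n\<^esub>"
      if v: "v \<in> ?V - (\<lambda>j. j # w) ` ?L" for v
    proof -
      obtain j u where ju: "v = j # u"
        using v vertices_SucE [OF _ n] by (metis DiffD1)
      then have "u \<noteq> w"
        using v by (auto simp: out_labels_def)
      then show ?thesis
        using v ju entry [of j u] fV [of v] by simp
    qed
  qed (use closed in auto)
  also have "\<dots> = (\<Oplus>\<^bsub>base_ring n\<^esub>j\<in>?L. diff_entry n d (j # w) w \<otimes>\<^bsub>base_ring n\<^esub> f (j # w))"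
    by (rule R.finsum_reindex) (use closed in \<open>auto simp: out_labels_def inj_on_def\<close>)
  also have "\<dots> = (\<Oplus>\<^bsub>base_ring n\<^esub>j\<in>?L. ring_var n j \<otimes>\<^bsub>base_ring n\<^esub> f (j # w))"
    by (rule R.finsum_cong') (use entry x fV in \<open>auto simp: out_labels_def\<close>)
  finally show ?thesis .
qed

section \<open>Exactness\<close>

lemma out_labels_Cons:
  assumes "1 \<le> n" "i # w \<in> vertices I n (Suc d)"
  shows "out_labels I n (Suc d) (i # w) = {j\<in>{1..n}. poly_var i * poly_var j \<in> I}"
  unfolding out_labels_def Cons_Cons_mem_vertices_iff [OF assms] by blast

lemma chain_diff_summand_closed:
  fixes f :: "vertex \<Rightarrow> 'k::field mpoly set"
  assumes n: "1 \<le> n" and f: "f \<in> carrier (chain_module n (Suc d))"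
    and j: "j \<in> out_labels (rel_ideal n :: 'k mpoly set) n d w"
  shows "ring_var n j \<in> carrier (base_ring n :: 'k mpoly set ring)"
    and "f (j # w) \<in> carrier (base_ring n)"
    and "ring_var n j \<otimes>\<^bsub>base_ring n\<^esub> f (j # w) \<in> carrier (base_ring n)"
proof -
  interpret R: cring "base_ring n :: 'k mpoly set ring" by (rule base_ring_cring [OF n])
  show x: "ring_var n j \<in> carrier (base_ring n :: 'k mpoly set ring)"
    using out_labels_subset [OF n] j by (intro ring_var_closed) blast
  show fj: "f (j # w) \<in> carrier (base_ring n)"
    using f j unfolding mem_chain_module [OF n] out_labels_def by blast
  show "ring_var n j \<otimes>\<^bsub>base_ring n\<^esub> f (j # w) \<in> carrier (base_ring n)"
    using x fj by (rule R.m_closed)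
qed

lemma chain_diff_closed:
  fixes f :: "vertex \<Rightarrow> 'k::field mpoly set"
  assumes n: "1 \<le> n" and f: "f \<in> carrier (chain_module n (Suc d))"
  shows "chain_diff n d f \<in> carrier (chain_module n d)"
proof -
  interpret R: cring "base_ring n :: 'k mpoly set ring" by (rule base_ring_cring [OF n])
  have "chain_diff n d f w \<in> carrier (base_ring n)"
    if "w \<in> vertices (rel_ideal n :: 'k mpoly set) n d" for w
    unfolding chain_diff_apply [OF n f that]
    by (rule R.finsum_closed) (use chain_diff_summand_closed [OF n f] in blast)
  then show ?thesis
    unfolding mem_chain_module [OF n] by (auto simp: chain_diff_def)
qed

lemma chain_diff_linear:
  assumes n: "1 \<le> n"
  shows "chain_diff n d \<in> linear_maps (base_ring n :: 'k::field mpoly set ring)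
    (chain_module n (Suc d)) (chain_module n d)"
proof -
  interpret R: cring "base_ring n :: 'k mpoly set ring" by (rule base_ring_cring [OF n])
  let ?I = "rel_ideal n :: 'k mpoly set"
  let ?F = "chain_module n :: nat \<Rightarrow> ('k mpoly set, vertex \<Rightarrow> 'k mpoly set) module"
  interpret F: module "base_ring n :: 'k mpoly set ring" "?F (Suc d)"
    unfolding chain_module_def by (rule R.free_module_on_module)
  have add: "chain_diff n d (f \<oplus>\<^bsub>?F (Suc d)\<^esub> g) = chain_diff n d f \<oplus>\<^bsub>?F d\<^esub> chain_diff n d g"
    if f: "f \<in> carrier (?F (Suc d))" and g: "g \<in> carrier (?F (Suc d))" for f g
  proof -
    have "chain_diff n d (f \<oplus>\<^bsub>?F (Suc d)\<^esub> g) w = chain_diff n d f w \<oplus>\<^bsub>base_ring n\<^esub> chain_diff n d g w"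
      if w: "w \<in> vertices ?I n d" for w
    proof -
      let ?L = "out_labels ?I n d w"
      note cf = chain_diff_summand_closed [OF n f, of _ w] and cg = chain_diff_summand_closed [OF n g, of _ w]
      have "chain_diff n d (f \<oplus>\<^bsub>?F (Suc d)\<^esub> g) w = (\<Oplus>\<^bsub>base_ring n\<^esub>j\<in>?L.
          ring_var n j \<otimes>\<^bsub>base_ring n\<^esub> f (j # w) \<oplus>\<^bsub>base_ring n\<^esub> ring_var n j \<otimes>\<^bsub>base_ring n\<^esub> g (j # w))"
        unfolding chain_diff_apply [OF n F.a_closed [OF f g] w]
      proof (rule R.finsum_cong')
        fix j assume j: "j \<in> ?L"
        then have "(f \<oplus>\<^bsub>?F (Suc d)\<^esub> g) (j # w) = f (j # w) \<oplus>\<^bsub>base_ring n\<^esub> g (j # w)"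
          by (simp add: chain_module_def out_labels_def del: vertices.simps)
        then show "ring_var n j \<otimes>\<^bsub>base_ring n\<^esub> (f \<oplus>\<^bsub>?F (Suc d)\<^esub> g) (j # w) =
            ring_var n j \<otimes>\<^bsub>base_ring n\<^esub> f (j # w) \<oplus>\<^bsub>base_ring n\<^esub> ring_var n j \<otimes>\<^bsub>base_ring n\<^esub> g (j # w)"
          using cf [OF j] cg [OF j] by (simp add: R.r_distr)
      qed (use cf cg in auto)
      also have "\<dots> = chain_diff n d f w \<oplus>\<^bsub>base_ring n\<^esub> chain_diff n d g w"
        unfolding chain_diff_apply [OF n f w] chain_diff_apply [OF n g w]
        by (rule R.finsum_addf) (use cf cg in auto)
      finally show ?thesis .
    qed
    then show ?thesis
      by (intro extensionalityI [where A = "vertices ?I n d"])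
        (simp_all add: chain_diff_def chain_module_def del: vertices.simps)
  qed
  have smult: "chain_diff n d (a \<odot>\<^bsub>?F (Suc d)\<^esub> f) = a \<odot>\<^bsub>?F d\<^esub> chain_diff n d f"
    if a: "a \<in> carrier (base_ring n)" and f: "f \<in> carrier (?F (Suc d))" for a f
  proof -
    have "chain_diff n d (a \<odot>\<^bsub>?F (Suc d)\<^esub> f) w = a \<otimes>\<^bsub>base_ring n\<^esub> chain_diff n d f w"
      if w: "w \<in> vertices ?I n d" for w
    proof -
      let ?L = "out_labels ?I n d w"
      note cf = chain_diff_summand_closed [OF n f, of _ w]
      have fin: "finite ?L"
        using out_labels_subset [OF n] by (rule finite_subset) simp
      have "chain_diff n d (a \<odot>\<^bsub>?F (Suc d)\<^esub> f) w = (\<Oplus>\<^bsub>base_ring n\<^esub>j\<in>?L.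
          a \<otimes>\<^bsub>base_ring n\<^esub> (ring_var n j \<otimes>\<^bsub>base_ring n\<^esub> f (j # w)))"
        unfolding chain_diff_apply [OF n F.smult_closed [OF a f] w]
      proof (rule R.finsum_cong')
        fix j assume j: "j \<in> ?L"
        then have "(a \<odot>\<^bsub>?F (Suc d)\<^esub> f) (j # w) = a \<otimes>\<^bsub>base_ring n\<^esub> f (j # w)"
          by (simp add: chain_module_def out_labels_def del: vertices.simps)
        then show "ring_var n j \<otimes>\<^bsub>base_ring n\<^esub> (a \<odot>\<^bsub>?F (Suc d)\<^esub> f) (j # w) =
            a \<otimes>\<^bsub>base_ring n\<^esub> (ring_var n j \<otimes>\<^bsub>base_ring n\<^esub> f (j # w))"
          using cf [OF j] a by (simp add: R.m_lcomm)
      qed (use cf a in auto)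
      also have "\<dots> = a \<otimes>\<^bsub>base_ring n\<^esub> chain_diff n d f w"
        unfolding chain_diff_apply [OF n f w]
        by (rule R.finsum_rdistr [symmetric, OF fin a]) (use cf in auto)
      finally show ?thesis .
    qed
    then show ?thesis
      by (intro extensionalityI [where A = "vertices ?I n d"])
        (simp_all add: chain_diff_def chain_module_def del: vertices.simps)
  qed
  show ?thesis
    unfolding linear_maps_def using chain_diff_closed [OF n] add smult by blast
qed

text \<open>By sparsity the component at \<open>w\<close> is a sum of multiples of distinct variables, and such
  a sum is zero only if every summand is. The kernel is therefore the product over the vertices
  \<open>j # w\<close> of the annihilators of \<open>x\<^sub>j\<close>.\<close>

lemma chain_diff_eq_zero_iff:
  fixes f :: "vertex \<Rightarrow> 'k::field mpoly set"
  assumes n: "1 \<le> n" and f: "f \<in> carrier (chain_module n (Suc d))"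
  shows "chain_diff n d f = \<zero>\<^bsub>chain_module n d\<^esub> \<longleftrightarrow>
    (\<forall>j w. j # w \<in> vertices (rel_ideal n :: 'k mpoly set) n (Suc d) \<longrightarrow>
      ring_var n j \<otimes>\<^bsub>base_ring n\<^esub> f (j # w) = \<zero>\<^bsub>base_ring n\<^esub>)"
proof -
  interpret R: cring "base_ring n :: 'k mpoly set ring" by (rule base_ring_cring [OF n])
  let ?I = "rel_ideal n :: 'k mpoly set"
  have "chain_diff n d f = \<zero>\<^bsub>chain_module n d\<^esub> \<longleftrightarrow>
      (\<forall>w\<in>vertices ?I n d. chain_diff n d f w = \<zero>\<^bsub>base_ring n\<^esub>)"
  proof
    assume "\<forall>w\<in>vertices ?I n d. chain_diff n d f w = \<zero>\<^bsub>base_ring n\<^esub>"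
    then show "chain_diff n d f = \<zero>\<^bsub>chain_module n d\<^esub>"
      by (intro extensionalityI [where A = "vertices ?I n d"])
        (simp_all add: chain_diff_def chain_module_def del: vertices.simps)
  qed (simp add: chain_module_def)
  also have "\<dots> \<longleftrightarrow> (\<forall>w\<in>vertices ?I n d. \<forall>j\<in>out_labels ?I n d w.
      ring_var n j \<otimes>\<^bsub>base_ring n\<^esub> f (j # w) = \<zero>\<^bsub>base_ring n\<^esub>)"
  proof (rule ball_cong [OF refl])
    fix w assume w: "w \<in> vertices ?I n d"
    show "chain_diff n d f w = \<zero>\<^bsub>base_ring n\<^esub> \<longleftrightarrow> (\<forall>j\<in>out_labels ?I n d w.
        ring_var n j \<otimes>\<^bsub>base_ring n\<^esub> f (j # w) = \<zero>\<^bsub>base_ring n\<^esub>)"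
    proof
      assume "chain_diff n d f w = \<zero>\<^bsub>base_ring n\<^esub>"
      then show "\<forall>j\<in>out_labels ?I n d w. ring_var n j \<otimes>\<^bsub>base_ring n\<^esub> f (j # w) = \<zero>\<^bsub>base_ring n\<^esub>"
        unfolding chain_diff_apply [OF n f w]
        using ring_var_multiples_independent [OF n out_labels_subset [OF n], where a = "\<lambda>j. f (j # w)"]
          chain_diff_summand_closed(2) [OF n f] by blast
    next
      assume "\<forall>j\<in>out_labels ?I n d w. ring_var n j \<otimes>\<^bsub>base_ring n\<^esub> f (j # w) = \<zero>\<^bsub>base_ring n\<^esub>"
      then show "chain_diff n d f w = \<zero>\<^bsub>base_ring n\<^esub>"
        unfolding chain_diff_apply [OF n f w] by (intro R.add.finprod_one_eqI) blast
    qed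
  qed
  also have "\<dots> \<longleftrightarrow> (\<forall>j w. j # w \<in> vertices ?I n (Suc d) \<longrightarrow>
      ring_var n j \<otimes>\<^bsub>base_ring n\<^esub> f (j # w) = \<zero>\<^bsub>base_ring n\<^esub>)"
    using arrowsD(3) [OF _ n] unfolding out_labels_def Cons_mem_vertices_iff [OF n] by blast
  finally show ?thesis .
qed

text \<open>Over each vertex \<open>i # w\<close> the kernel is the annihilator of \<open>x\<^sub>i\<close>, and the image is the ideal
  generated by the labels of the arrows into that vertex. The two agree by
  \<open>annihilator_of_ring_var\<close>, and the preimages chosen at different vertices do not interfere,
  since every vertex of the next degree lies above only one of them.\<close>

lemma chain_diff_exact:
  assumes n: "1 \<le> n"
  shows "a_kernel (chain_module n (Suc d)) (chain_module n d) (chain_diff n d) =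
    chain_diff n (Suc d) ` carrier (chain_module n (Suc (Suc d)) ::
      ('k::field mpoly set, vertex \<Rightarrow> 'k mpoly set) module)" (is "?K = ?B")
proof
  interpret R: cring "base_ring n :: 'k mpoly set ring" by (rule base_ring_cring [OF n])
  let ?I = "rel_ideal n :: 'k mpoly set"
  let ?F = "chain_module n :: nat \<Rightarrow> ('k mpoly set, vertex \<Rightarrow> 'k mpoly set) module"
  show "?B \<subseteq> ?K"
  proof
    fix f assume "f \<in> ?B"
    then obtain g where g: "g \<in> carrier (?F (Suc (Suc d)))" and fg: "f = chain_diff n (Suc d) g"
      by blast
    have f: "f \<in> carrier (?F (Suc d))"
      unfolding fg by (rule chain_diff_closed [OF n g])
    have "ring_var n i \<otimes>\<^bsub>base_ring n\<^esub> f (i # w) = \<zero>\<^bsub>base_ring n\<^esub>"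
      if v: "i # w \<in> vertices ?I n (Suc d)" for i w
    proof -
      let ?L = "out_labels ?I n (Suc d) (i # w)"
      have i: "i \<in> {1..n}"
        using v arrowsD(2) [OF _ n] unfolding Cons_mem_vertices_iff [OF n] by blast
      have xi: "ring_var n i \<in> carrier (base_ring n :: 'k mpoly set ring)"
        by (rule ring_var_closed [OF i])
      have fin: "finite ?L"
        using out_labels_subset [OF n] by (rule finite_subset) simp
      note cg = chain_diff_summand_closed [OF n g, of _ "i # w"]
      have "ring_var n i \<otimes>\<^bsub>base_ring n\<^esub> f (i # w) = (\<Oplus>\<^bsub>base_ring n\<^esub>j\<in>?L.
          ring_var n i \<otimes>\<^bsub>base_ring n\<^esub> (ring_var n j \<otimes>\<^bsub>base_ring n\<^esub> g (j # i # w)))"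
        unfolding fg chain_diff_apply [OF n g v]
        by (rule R.finsum_rdistr [OF fin xi]) (use cg in auto)
      also have "\<dots> = \<zero>\<^bsub>base_ring n\<^esub>"
      proof (rule R.add.finprod_one_eqI)
        fix j assume j: "j \<in> ?L"
        then have "ring_var n i \<otimes>\<^bsub>base_ring n\<^esub> ring_var n j = (\<zero>\<^bsub>base_ring n\<^esub> :: 'k mpoly set)"
          using out_labels_Cons [OF n v] i by (subst ring_var_mult_eq_zero_iff [OF n]) auto
        then show "ring_var n i \<otimes>\<^bsub>base_ring n\<^esub> (ring_var n j \<otimes>\<^bsub>base_ring n\<^esub> g (j # i # w)) = \<zero>\<^bsub>base_ring n\<^esub>"
          using cg [OF j] xi by (simp flip: R.m_assoc)
      qed
      finally show ?thesis .
    qed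
    then show "f \<in> ?K"
      using f chain_diff_eq_zero_iff [OF n f] unfolding a_kernel_def' by blast
  qed
  show "?K \<subseteq> ?B"
  proof
    fix f assume "f \<in> ?K"
    then have f: "f \<in> carrier (?F (Suc d))" and "chain_diff n d f = \<zero>\<^bsub>?F d\<^esub>"
      unfolding a_kernel_def' by blast+
    then have ann: "ring_var n i \<otimes>\<^bsub>base_ring n\<^esub> f (i # w) = \<zero>\<^bsub>base_ring n\<^esub>"
      if "i # w \<in> vertices ?I n (Suc d)" for i w
      using that chain_diff_eq_zero_iff [OF n f] by blast
    have "\<exists>r. (\<forall>j. r j \<in> carrier (base_ring n)) \<and>
        f v = (\<Oplus>\<^bsub>base_ring n\<^esub>j\<in>out_labels ?I n (Suc d) v. ring_var n j \<otimes>\<^bsub>base_ring n\<^esub> r j)"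
      if v: "v \<in> vertices ?I n (Suc d)" for v
    proof -
      obtain i w where iw: "v = i # w" "i \<in> {1..n}"
        using vertices_SucE [OF v n] by metis
      have "f v \<in> carrier (base_ring n)"
        using f v unfolding mem_chain_module [OF n] by blast
      moreover have "ring_var n i \<otimes>\<^bsub>base_ring n\<^esub> f v = \<zero>\<^bsub>base_ring n\<^esub>"
        using ann [of i w] v by (simp only: iw(1))
      ultimately obtain r where "\<And>j. r j \<in> carrier (base_ring n)"
        and "f v = (\<Oplus>\<^bsub>base_ring n\<^esub>j\<in>{j\<in>{1..n}. poly_var i * poly_var j \<in> ?I}. ring_var n j \<otimes>\<^bsub>base_ring n\<^esub> r j)"
        using annihilator_of_ring_var [OF n iw(2)] by blast
      moreover have "out_labels ?I n (Suc d) v = {j\<in>{1..n}. poly_var i * poly_var j \<in> ?I}"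
        using v unfolding iw(1) by (rule out_labels_Cons [OF n])
      ultimately show ?thesis
        by auto
    qed
    then have "\<forall>v\<in>vertices ?I n (Suc d). \<exists>r. (\<forall>j. r j \<in> carrier (base_ring n)) \<and>
        f v = (\<Oplus>\<^bsub>base_ring n\<^esub>j\<in>out_labels ?I n (Suc d) v. ring_var n j \<otimes>\<^bsub>base_ring n\<^esub> r j)"
      by (rule ballI)
    from bchoice [OF this] obtain r where "\<forall>v\<in>vertices ?I n (Suc d). (\<forall>j. r v j \<in> carrier (base_ring n)) \<and>
        f v = (\<Oplus>\<^bsub>base_ring n\<^esub>j\<in>out_labels ?I n (Suc d) v. ring_var n j \<otimes>\<^bsub>base_ring n\<^esub> r v j)"
      by (rule exE)
    then have r: "r v j \<in> carrier (base_ring n)"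
      and fr: "f v = (\<Oplus>\<^bsub>base_ring n\<^esub>j\<in>out_labels ?I n (Suc d) v. ring_var n j \<otimes>\<^bsub>base_ring n\<^esub> r v j)"
      if "v \<in> vertices ?I n (Suc d)" for v j
      using that by (simp_all only: Ball_def)
    \<comment> \<open>A vertex \<open>u = j # v\<close> carries the coefficient of \<open>x\<^sub>j\<close> in the expansion of \<open>f v\<close>.\<close>
    define g where "g = (\<lambda>u\<in>vertices ?I n (Suc (Suc d)). r (tl u) (hd u))"
    have "r (tl u) (hd u) \<in> carrier (base_ring n)" if u: "u \<in> vertices ?I n (Suc (Suc d))" for u
    proof -
      obtain j v where "u = j # v" "v \<in> vertices ?I n (Suc d)"
        using vertices_SucE [OF u n] by metis
      then show ?thesis
        using r by simp
    qed
    then have g: "g \<in> carrier (?F (Suc (Suc d)))"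
      unfolding mem_chain_module [OF n] g_def restrict_PiE_iff by blast
    have "chain_diff n (Suc d) g v = f v" if v: "v \<in> vertices ?I n (Suc d)" for v
      unfolding chain_diff_apply [OF n g v] fr [OF v]
    proof (rule R.finsum_cong')
      show "(\<lambda>j. ring_var n j \<otimes>\<^bsub>base_ring n\<^esub> r v j) \<in> out_labels ?I n (Suc d) v \<rightarrow> carrier (base_ring n)"
        using chain_diff_summand_closed(1) [OF n g] r [OF v] by auto
    qed (simp_all add: g_def out_labels_def del: vertices.simps)
    moreover have "f \<in> extensional (vertices ?I n (Suc d))"
      using f unfolding mem_chain_module [OF n] PiE_iff by blast
    ultimately have "chain_diff n (Suc d) g = f"
      by (intro extensionalityI [where A = "vertices ?I n (Suc d)"])
        (simp_all add: chain_diff_def del: vertices.simps)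
    then show "f \<in> ?B"
      using g by blast
  qed
qed

lemma var1_ideal_eq:
  assumes n: "1 \<le> n"
  shows "ideal (var1_ideal n) (base_ring n :: 'k::field mpoly set ring)"
    and "(var1_ideal n :: 'k mpoly set set) =
      {ring_var n 1 \<otimes>\<^bsub>base_ring n\<^esub> r | r. r \<in> carrier (base_ring n)}"
proof -
  interpret R: cring "base_ring n :: 'k mpoly set ring" by (rule base_ring_cring [OF n])
  have x: "ring_var n 1 \<in> carrier (base_ring n :: 'k mpoly set ring)"
    using n by (intro ring_var_closed) simp
  show "ideal (var1_ideal n) (base_ring n :: 'k mpoly set ring)"
    unfolding var1_ideal_def by (rule R.genideal_ideal) (use x in blast)
  have "y = r \<otimes>\<^bsub>base_ring n\<^esub> ring_var n 1 \<and> r \<in> carrier (base_ring n) \<longleftrightarrow>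
      y = ring_var n 1 \<otimes>\<^bsub>base_ring n\<^esub> r \<and> r \<in> carrier (base_ring n)" for y r :: "'k mpoly set"
    using R.m_comm [OF x, of r] by metis
  then show "(var1_ideal n :: 'k mpoly set set) =
      {ring_var n 1 \<otimes>\<^bsub>base_ring n\<^esub> r | r. r \<in> carrier (base_ring n)}"
    unfolding var1_ideal_def R.cgenideal_eq_genideal [OF x, symmetric] cgenideal_def
    by presburger
qed

lemma augmentation_linear:
  assumes n: "1 \<le> n"
  shows "augmentation n \<in> linear_maps (base_ring n :: 'k::field mpoly set ring)
    (chain_module n 0) (quotient_module (base_ring n) (var1_ideal n))"
proof -
  interpret R: cring "base_ring n :: 'k mpoly set ring" by (rule base_ring_cring [OF n])
  interpret h: ring_hom_cring "base_ring n" "base_ring n Quot (var1_ideal n :: 'k mpoly set set)"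
    "(+>\<^bsub>base_ring n\<^esub>) (var1_ideal n)"
    by (rule ideal.rcos_ring_hom_cring [OF var1_ideal_eq(1) [OF n] R.is_cring])
  have "f [] \<in> carrier (base_ring n)" if "f \<in> carrier (chain_module n 0)" for f :: "vertex \<Rightarrow> 'k mpoly set"
    using that unfolding mem_chain_module [OF n] by auto
  then show ?thesis
    by (simp add: linear_maps_def augmentation_def quotient_module_def chain_module_def)
qed

lemma augmentation_surj:
  assumes n: "1 \<le> n"
  shows "augmentation n ` carrier (chain_module n 0 :: ('k::field mpoly set, vertex \<Rightarrow> 'k mpoly set) module) =
    carrier (quotient_module (base_ring n) (var1_ideal n))"
proof
  show "augmentation n ` carrier (chain_module n 0 :: ('k mpoly set, vertex \<Rightarrow> 'k mpoly set) module) \<subseteq>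
      carrier (quotient_module (base_ring n) (var1_ideal n))"
    using augmentation_linear [OF n] unfolding linear_maps_def by blast
  show "carrier (quotient_module (base_ring n) (var1_ideal n)) \<subseteq>
      augmentation n ` carrier (chain_module n 0 :: ('k mpoly set, vertex \<Rightarrow> 'k mpoly set) module)"
  proof
    fix X :: "'k mpoly set set"
    assume "X \<in> carrier (quotient_module (base_ring n) (var1_ideal n))"
    then obtain a where a: "a \<in> carrier (base_ring n)" "X = var1_ideal n +>\<^bsub>base_ring n\<^esub> a"
      unfolding quotient_module_def FactRing_def A_RCOSETS_def RCOSETS_def a_r_coset_def by auto
    then have "(\<lambda>v\<in>{[]}. a) \<in> carrier (chain_module n 0 :: ('k mpoly set, vertex \<Rightarrow> 'k mpoly set) module)"
      unfolding mem_chain_module [OF n] by auto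
    then show "X \<in> augmentation n ` carrier (chain_module n 0 :: ('k mpoly set, vertex \<Rightarrow> 'k mpoly set) module)"
      by (rule rev_image_eqI) (simp add: augmentation_def a(2))
  qed
qed

text \<open>Degree 1 has the single vertex \<open>[1]\<close>, with label 1, so the first differential is
  multiplication by \<open>x\<^sub>1\<close> on the ring.\<close>

lemma augmentation_exact:
  assumes n: "1 \<le> n"
  shows "a_kernel (chain_module n 0) (quotient_module (base_ring n) (var1_ideal n)) (augmentation n) =
    chain_diff n 0 ` carrier (chain_module n 1 :: ('k::field mpoly set, vertex \<Rightarrow> 'k mpoly set) module)"
    (is "?K = ?B")
proof -
  interpret R: cring "base_ring n :: 'k mpoly set ring" by (rule base_ring_cring [OF n])
  interpret J: ideal "var1_ideal n" "base_ring n :: 'k mpoly set ring" by (rule var1_ideal_eq(1) [OF n])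
  let ?F = "chain_module n :: nat \<Rightarrow> ('k mpoly set, vertex \<Rightarrow> 'k mpoly set) module"
  have F0: "f \<in> carrier (?F 0) \<longleftrightarrow> f \<in> extensional {[]} \<and> f [] \<in> carrier (base_ring n)" for f
    unfolding mem_chain_module [OF n] by (auto simp: PiE_iff)
  have F1: "g \<in> carrier (?F (Suc 0)) \<longleftrightarrow> g \<in> extensional {[1]} \<and> g [1] \<in> carrier (base_ring n)" for g
    unfolding mem_chain_module [OF n] by (auto simp: PiE_iff)
  have labels: "out_labels (rel_ideal n :: 'k mpoly set) n 0 [] = {1}"
    by (auto simp: out_labels_def)
  have x: "ring_var n 1 \<in> carrier (base_ring n :: 'k mpoly set ring)"
    using n by (intro ring_var_closed) simp
  have diff: "chain_diff n 0 g [] = ring_var n 1 \<otimes>\<^bsub>base_ring n\<^esub> g [1]" if "g \<in> carrier (?F (Suc 0))" for g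
    using that x chain_diff_apply [OF n that, of "[]"] by (simp add: labels F1)
  have K: "f \<in> ?K \<longleftrightarrow> f \<in> carrier (?F 0) \<and> f [] \<in> var1_ideal n" for f
  proof -
    have "var1_ideal n +>\<^bsub>base_ring n\<^esub> f [] = var1_ideal n \<longleftrightarrow> f [] \<in> var1_ideal n"
      if "f [] \<in> carrier (base_ring n)"
      using that J.rcos_const_imp_mem J.a_rcos_const by blast
    then show ?thesis
      by (auto simp: a_kernel_def' augmentation_def quotient_module_def FactRing_def F0)
  qed
  show ?thesis
  proof
    show "?B \<subseteq> ?K"
    proof
      fix f assume "f \<in> ?B"
      then obtain g where g: "g \<in> carrier (?F (Suc 0))" and fg: "f = chain_diff n 0 g"
        by auto
      have "f [] \<in> var1_ideal n"
        using diff [OF g] g unfolding fg var1_ideal_eq(2) [OF n] F1 by blast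
      then show "f \<in> ?K"
        using chain_diff_closed [OF n g] by (simp add: K fg)
    qed
    show "?K \<subseteq> ?B"
    proof
      fix f assume "f \<in> ?K"
      then have f: "f \<in> extensional {[]}" and "f [] \<in> var1_ideal n"
        by (simp_all add: K F0)
      then obtain r where r: "r \<in> carrier (base_ring n)" "f [] = ring_var n 1 \<otimes>\<^bsub>base_ring n\<^esub> r"
        unfolding var1_ideal_eq(2) [OF n] by blast
      define g where "g = (\<lambda>v\<in>{[1::nat]}. r)"
      have g: "g \<in> carrier (?F (Suc 0))"
        using r(1) by (simp add: F1 g_def)
      have "chain_diff n 0 g = f"
        by (rule extensionalityI [where A = "{[]}"])
          (use f r(2) diff [OF g] in \<open>auto simp: chain_diff_def g_def\<close>)
      then show "f \<in> ?B"
        using g by auto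
    qed
  qed
qed

theorem theorem14:
  fixes n :: nat
  assumes "n \<ge> 2"
  shows "free_resolution (base_ring n :: 'k::field mpoly set ring)
    (chain_module n) (chain_diff n)
    (quotient_module (base_ring n) (var1_ideal n)) (augmentation n)"
proof -
  have n: "1 \<le> n"
    using assms by simp
  interpret R: cring "base_ring n :: 'k mpoly set ring" by (rule base_ring_cring [OF n])
  show ?thesis
    unfolding free_resolution_def
  proof (intro conjI allI)
    show "module (base_ring n :: 'k mpoly set ring) (quotient_module (base_ring n) (var1_ideal n))"
      by (rule R.quotient_module_module [OF var1_ideal_eq(1) [OF n]])
    show "free_module (base_ring n :: 'k mpoly set ring) (chain_module n d)" for d
      unfolding chain_module_def by (rule R.free_module_on_free [OF base_ring_nontrivial [OF n]])
  qed (fact chain_diff_linear [OF n] augmentation_linear [OF n] augmentation_surj [OF n]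
      augmentation_exact [OF n] chain_diff_exact [OF n])+
qed

end
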